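(* The numbers of proper elements in the exceptional finite irreducible Coxeter groups are: $10690$ in type $E_6$; $159368$ in type $E_7$; $4854344$ in type $E_8$; $297$ in type $F_4$; $48$ in type $H_3$; and $594$ in type $H_4$.
   Context: Let $(W,S)$ be a finite Coxeter system with $S=\{s_1,\dots,s_n\}$ of rank $n$ and Coxeter length $\ell$. For $I\subseteq[n]=\{1,\dots,n\}$ let $W_I$ be the parabolic subgroup generated by $\{s_i\mid i\in I\}$, with longest element $w_0(W_I)$. For $w\in W$ let $d(w)=\#\{j\in[n]\mid \ell(s_jw)<\ell(w)\}$ be the number of left descents. Put $\mathsf{maxw}_0(W,x)=\max\{\ell(w_0(W_I))\mid I\subseteq[n],\ |I|=x\}$. An element $w\in W$ is proper if $\ell(w)\le n+\mathsf{maxw}_0(W,d(w))$. *)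

theory Defs
  imports "HOL-Algebra.Generated_Groups"
begin

(* A Coxeter matrix on {1..n}; the entry 0 stands for infinity, which agrees with
   the relation (s_i s_j)^0 = 1 being void. *)
definition coxeter_matrix :: "nat \<Rightarrow> (nat \<Rightarrow> nat \<Rightarrow> nat) \<Rightarrow> bool" where
  "coxeter_matrix n m \<longleftrightarrow>
     (\<forall>i\<in>{1..n}. m i i = 1) \<and>
     (\<forall>i\<in>{1..n}. \<forall>j\<in>{1..n}. m i j = m j i \<and> (i \<noteq> j \<longrightarrow> m i j \<noteq> 1))"

(* The congruence on the free monoid over {1..n} generated by (s_i s_j)^{m i j} = 1.
   The case i = j gives s_i s_i = 1, so every generator is its own inverse and the
   quotient monoid is the group presented by the same generators and relations. *)
inductive coxeter_congruence ::
    "nat \<Rightarrow> (nat \<Rightarrow> nat \<Rightarrow> nat) \<Rightarrow> nat list \<Rightarrow> nat list \<Rightarrow> bool"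
  for n :: nat and m :: "nat \<Rightarrow> nat \<Rightarrow> nat" where
  relator: "\<lbrakk>i \<in> {1..n}; j \<in> {1..n}; u \<in> lists {1..n}; v \<in> lists {1..n}\<rbrakk> \<Longrightarrow>
      coxeter_congruence n m (u @ concat (replicate (m i j) [i, j]) @ v) (u @ v)"
| refl: "u \<in> lists {1..n} \<Longrightarrow> coxeter_congruence n m u u"
| sym: "coxeter_congruence n m u v \<Longrightarrow> coxeter_congruence n m v u"
| trans: "\<lbrakk>coxeter_congruence n m u v; coxeter_congruence n m v w\<rbrakk> \<Longrightarrow>
      coxeter_congruence n m u w"

definition word_value :: "('a, 'b) monoid_scheme \<Rightarrow> (nat \<Rightarrow> 'a) \<Rightarrow> nat list \<Rightarrow> 'a" where
  "word_value W s u = foldr (\<lambda>i w. s i \<otimes>\<^bsub>W\<^esub> w) u \<one>\<^bsub>W\<^esub>"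

(* W has the presentation < s_1, ..., s_n | (s_i s_j)^{m i j} = 1 >. *)
locale coxeter_system = group W
  for W :: "('a, 'b) monoid_scheme" (structure) +
  fixes n :: nat and s :: "nat \<Rightarrow> 'a" and m :: "nat \<Rightarrow> nat \<Rightarrow> nat"
  assumes matrix: "coxeter_matrix n m"
    and generator_closed: "i \<in> {1..n} \<Longrightarrow> s i \<in> carrier W"
    and generated: "carrier W = generate W (s ` {1..n})"
    and relations: "\<lbrakk>i \<in> {1..n}; j \<in> {1..n}\<rbrakk> \<Longrightarrow> (s i \<otimes> s j) [^] m i j = \<one>"
    and presented: "\<lbrakk>u \<in> lists {1..n}; v \<in> lists {1..n};
      word_value W s u = word_value W s v\<rbrakk> \<Longrightarrow> coxeter_congruence n m u v"

locale finite_coxeter_system = coxeter_system +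
  assumes finite_carrier: "finite (carrier W)"

definition coxeter_length ::
    "('a, 'b) monoid_scheme \<Rightarrow> nat \<Rightarrow> (nat \<Rightarrow> 'a) \<Rightarrow> 'a \<Rightarrow> nat" where
  "coxeter_length W n s w =
     (LEAST k. \<exists>u\<in>lists {1..n}. length u = k \<and> word_value W s u = w)"

definition parabolic ::
    "('a, 'b) monoid_scheme \<Rightarrow> (nat \<Rightarrow> 'a) \<Rightarrow> nat set \<Rightarrow> 'a set" where
  "parabolic W s I = generate W (s ` I)"

definition longest_element ::
    "('a, 'b) monoid_scheme \<Rightarrow> nat \<Rightarrow> (nat \<Rightarrow> 'a) \<Rightarrow> nat set \<Rightarrow> 'a" where
  "longest_element W n s I = (ARG_MAX (coxeter_length W n s) w. w \<in> parabolic W s I)"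

definition left_descent_number ::
    "('a, 'b) monoid_scheme \<Rightarrow> nat \<Rightarrow> (nat \<Rightarrow> 'a) \<Rightarrow> 'a \<Rightarrow> nat" where
  "left_descent_number W n s w =
     card {j \<in> {1..n}. coxeter_length W n s (s j \<otimes>\<^bsub>W\<^esub> w) < coxeter_length W n s w}"

definition maxw0 ::
    "('a, 'b) monoid_scheme \<Rightarrow> nat \<Rightarrow> (nat \<Rightarrow> 'a) \<Rightarrow> nat \<Rightarrow> nat" where
  "maxw0 W n s x =
     Max {coxeter_length W n s (longest_element W n s I) | I. I \<subseteq> {1..n} \<and> card I = x}"

definition proper_element ::
    "('a, 'b) monoid_scheme \<Rightarrow> nat \<Rightarrow> (nat \<Rightarrow> 'a) \<Rightarrow> 'a \<Rightarrow> bool" where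
  "proper_element W n s w \<longleftrightarrow>
     w \<in> carrier W \<and>
     coxeter_length W n s w \<le> n + maxw0 W n s (left_descent_number W n s w)"

(* The Coxeter matrix of a diagram given by its list of edges ((i, j), label) with i < j. *)
definition diagram_matrix :: "((nat \<times> nat) \<times> nat) list \<Rightarrow> nat \<Rightarrow> nat \<Rightarrow> nat" where
  "diagram_matrix E i j =
     (if i = j then 1
      else case map_of E (min i j, max i j) of None \<Rightarrow> 2 | Some k \<Rightarrow> k)"

(* Types E and F are numbered as in Bourbaki: in type E the chain is 1-3-4-5-..., and 2 is
   attached to 4. *)

definition E6_matrix :: "nat \<Rightarrow> nat \<Rightarrow> nat" where
  "E6_matrix = diagram_matrix
     [((1, 3), 3), ((3, 4), 3), ((2, 4), 3), ((4, 5), 3), ((5, 6), 3)]"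

definition E7_matrix :: "nat \<Rightarrow> nat \<Rightarrow> nat" where
  "E7_matrix = diagram_matrix
     [((1, 3), 3), ((3, 4), 3), ((2, 4), 3), ((4, 5), 3), ((5, 6), 3), ((6, 7), 3)]"

definition E8_matrix :: "nat \<Rightarrow> nat \<Rightarrow> nat" where
  "E8_matrix = diagram_matrix
     [((1, 3), 3), ((3, 4), 3), ((2, 4), 3), ((4, 5), 3), ((5, 6), 3), ((6, 7), 3), ((7, 8), 3)]"

definition F4_matrix :: "nat \<Rightarrow> nat \<Rightarrow> nat" where
  "F4_matrix = diagram_matrix [((1, 2), 3), ((2, 3), 4), ((3, 4), 3)]"

definition H3_matrix :: "nat \<Rightarrow> nat \<Rightarrow> nat" where
  "H3_matrix = diagram_matrix [((1, 2), 5), ((2, 3), 3)]"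

definition H4_matrix :: "nat \<Rightarrow> nat \<Rightarrow> nat" where
  "H4_matrix = diagram_matrix [((1, 2), 5), ((2, 3), 3), ((3, 4), 3)]"

end

(* W acts on the span of simple roots through a Cartan matrix, and l(w s_j) < l(w) holds
   exactly when w(alpha_j) has nonpositive coordinates.  Minimal coset representatives are
   therefore the w with w(alpha_k) >= 0 for all k in K, and their length generating
   polynomials satisfy H(J, K) = H(J, I) H(I, K) for K <= I <= J, where H(J, K) counts the
   minimal representatives of W_J / W_K.  The polynomials H(K + i, K) are obtained by a numbers
   game: w is recorded by the i-th coordinates of the roots w^-1(alpha_k), firing a positive
   coordinate lengthens w by one, and generating each state only from the firing of its first
   negative coordinate produces every representative exactly once.  Dividing the Poincare
   polynomial of W by these factors gives H(S, K) for all subsets K of the generators;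
   inclusion-exclusion over K turns them into the joint distribution of length and number of
   descents, and the degree of H(K, {}) is the length of the longest element of W_K. *)
theory Submission
  imports Defs "HOL-Computational_Algebra.Polynomial"
begin

section \<open>Coefficient rings\<close>

text \<open>Listing the 696729600 elements of E8 is out of reach of evaluation inside the logic.
  Every set \<open>I\<close> of nodes is built up in increasing order, so each game compares
  \<open>I\<close> only with \<open>I\<close> minus its largest node; the largest quotient that
  arises is E8 over E7, with 240 states. The Poincare polynomial is itself the product of the games
  along a full flag of parabolics, and every divisor has constant term 1, so division stays within
  the integers.

  \<open>W\<close> is known only through its presentation, so its roots must be constructed: the
  presentation makes the action on coordinate vectors well defined, and the sign rule for roots
  follows by induction on length through subgroups of rank two.

  Properness depends on how many descents there are, not on which ones. Hence the polynomials of all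
  \<open>K\<close> of one size can be added before inversion, and only binomial coefficients remain.
  The sign rule concerns right descents, while properness uses left ones; inversion of the group
  exchanges them.\<close>

text \<open>The order is only partial: for the golden ring it is the coefficientwise order on
  \<open>\<int>[\<phi>]\<close> and not the one inherited from the reals. Coordinates of roots are comparable
  to zero in this order, which keeps all sign tests inside the integers.\<close>

class cone_ring = comm_ring_1 + ordered_ab_group_add + zero_less_one +
  assumes cone_mult_pos: "0 < a \<Longrightarrow> 0 < b \<Longrightarrow> 0 < a * b"
begin

lemma cone_mult_nonneg: "0 \<le> a \<Longrightarrow> 0 \<le> b \<Longrightarrow> 0 \<le> a * b"
  by (metis cone_mult_pos less_le mult_zero_left mult_zero_right order_refl)

end

instance int :: cone_ring
  by standard simp

text \<open>\<open>Golden a b\<close> stands for \<open>a + b \<phi>\<close> with \<open>\<phi>\<^sup>2 = \<phi> + 1\<close>.\<close>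

datatype golden = Golden int int

instantiation golden :: cone_ring
begin

definition zero_golden where "0 = Golden 0 0"
definition one_golden where "1 = Golden 1 0"
fun plus_golden where "Golden a b + Golden c d = Golden (a + c) (b + d)"
fun minus_golden where "Golden a b - Golden c d = Golden (a - c) (b - d)"
fun uminus_golden where "- Golden a b = Golden (- a) (- b)"
fun times_golden where
  "Golden a b * Golden c d = Golden (a * c + b * d) (a * d + b * c + b * d)"
fun less_eq_golden where "Golden a b \<le> Golden c d \<longleftrightarrow> a \<le> c \<and> b \<le> d"
definition less_golden where "x < (y::golden) \<longleftrightarrow> x \<le> y \<and> \<not> y \<le> x"

instance
proof
  fix a b c :: golden
  show "a * b * c = a * (b * c)"
    by (cases a; cases b; cases c) (simp add: algebra_simps)
  show "a * b = b * a" "1 * a = a"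
    by (cases a; cases b; simp add: algebra_simps one_golden_def)+
  show "(a + b) * c = a * c + b * c"
    by (cases a; cases b; cases c) (simp add: algebra_simps)
  show "a + b + c = a + (b + c)" "a + b = b + a" "0 + a = a" "- a + a = 0" "a - b = a + - b"
    by (cases a; cases b; cases c; simp add: zero_golden_def)+
  show "(0::golden) \<noteq> 1" "(0::golden) < 1"
    by (simp_all add: zero_golden_def one_golden_def less_golden_def)
  show "(a < b) = (a \<le> b \<and> \<not> b \<le> a)"
    by (simp add: less_golden_def)
  show "a \<le> a" "a \<le> b \<Longrightarrow> b \<le> c \<Longrightarrow> a \<le> c" "a \<le> b \<Longrightarrow> b \<le> a \<Longrightarrow> a = b"
    "a \<le> b \<Longrightarrow> c + a \<le> c + b"
    by (cases a; cases b; cases c; simp)+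
  assume pos: "0 < a" "0 < b"
  obtain p q r t where ab: "a = Golden p q" "b = Golden r t"
    by (cases a; cases b)
  with pos have nonneg: "0 \<le> p" "0 \<le> q" "0 \<le> r" "0 \<le> t"
    and nonzero: "p \<noteq> 0 \<or> q \<noteq> 0" "r \<noteq> 0 \<or> t \<noteq> 0"
    by (auto simp: zero_golden_def less_golden_def)
  have "0 \<le> p * r" "0 \<le> p * t" "0 \<le> q * r" "0 \<le> q * t"
    using nonneg by simp_all
  \<comment> \<open>Both coefficients of \<open>a * b\<close> are sums of these nonnegative
    products, and each product occurs in one of them, so a single nonzero product makes
    \<open>a * b\<close> positive.\<close>
  moreover have "p * r \<noteq> 0 \<or> p * t \<noteq> 0 \<or> q * r \<noteq> 0 \<or> q * t \<noteq> 0"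
    using nonzero by auto
  ultimately show "0 < a * b"
    unfolding ab zero_golden_def less_golden_def times_golden.simps less_eq_golden.simps by linarith
qed

end

section \<open>The geometric representation\<close>

text \<open>Off-diagonal Cartan entries: \<open>a b = 4 cos\<^sup>2 (\<pi> / k)\<close>, and for \<open>k = 5\<close> the
  equation says \<open>a = - \<phi>\<close>.\<close>

definition bond :: "nat \<Rightarrow> 'r::cone_ring \<Rightarrow> 'r \<Rightarrow> bool" where
  "bond k a b \<longleftrightarrow>
     k = 2 \<and> a = 0 \<and> b = 0 \<or>
     k = 3 \<and> a = - 1 \<and> b = - 1 \<or>
     k = 4 \<and> (a = - 1 \<and> b = - 2 \<or> a = - 2 \<and> b = - 1) \<or>
     k = 5 \<and> a = b \<and> a \<le> 0 \<and> a * a = 1 - a"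

locale geometric_coxeter_system = finite_coxeter_system W n s m
  for W :: "('a, 'b) monoid_scheme" (structure) and n :: nat and s :: "nat \<Rightarrow> 'a"
    and m :: "nat \<Rightarrow> nat \<Rightarrow> nat" +
  fixes c :: "nat \<Rightarrow> nat \<Rightarrow> 'r::cone_ring"
  assumes diag: "i \<in> {1..n} \<Longrightarrow> c i i = 2"
    and bond: "\<lbrakk>i \<in> {1..n}; j \<in> {1..n}; i \<noteq> j\<rbrakk> \<Longrightarrow> bond (m i j) (c i j) (c j i)"
begin

definition S :: "nat set" where
  "S = {1..n}"

abbreviation "val \<equiv> word_value W s"
abbreviation "len \<equiv> coxeter_length W n s"

lemma finite_S [simp]: "finite S"
  by (simp add: S_def)

lemma diag_S: "i \<in> S \<Longrightarrow> c i i = 2"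
  using diag by (simp add: S_def)

definition pairing :: "nat \<Rightarrow> (nat \<Rightarrow> 'r) \<Rightarrow> 'r" where
  "pairing i v = (\<Sum>l\<in>S. c i l * v l)"

definition reflect :: "nat \<Rightarrow> (nat \<Rightarrow> 'r) \<Rightarrow> nat \<Rightarrow> 'r" where
  "reflect i v = v(i := v i - pairing i v)"

text \<open>Perturbs an arbitrary vector in two coordinates. A word in \<open>i\<close> and
  \<open>j\<close> applied to \<open>v\<close> moves only these two, so a braid relation reduces to
  two identities between ring expressions in the pairings of \<open>v\<close>, without splitting off
  the plane of the two roots.\<close>

definition shift :: "nat \<Rightarrow> 'r \<Rightarrow> nat \<Rightarrow> 'r \<Rightarrow> (nat \<Rightarrow> 'r) \<Rightarrow> nat \<Rightarrow> 'r" where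
  "shift i p j q v = (\<lambda>l. v l + (if l = i then p else 0) + (if l = j then q else 0))"

lemma pairing_shift:
  assumes "i \<in> S" "j \<in> S"
  shows "pairing k (shift i p j q v) = pairing k v + c k i * p + c k j * q"
proof -
  have "pairing k (shift i p j q v) =
      (\<Sum>l\<in>S. c k l * v l + (if l = i then c k l * p else 0) + (if l = j then c k l * q else 0))"
    unfolding pairing_def shift_def by (intro sum.cong) (auto simp: algebra_simps)
  then show ?thesis
    using assms by (simp add: sum.distrib pairing_def)
qed

lemma reflect_shift:
  assumes "i \<in> S" "j \<in> S"
  shows "reflect i (shift i p j q v) = shift i (- p - pairing i v - c i j * q) j q v"
  using assms by (auto simp: reflect_def fun_eq_iff pairing_shift diag_S) (auto simp: shift_def)

lemma shift_commute: "shift i p j q v = shift j q i p v"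
  by (auto simp: shift_def fun_eq_iff algebra_simps)

lemma reflect_shift':
  assumes "i \<in> S" "j \<in> S"
  shows "reflect j (shift i p j q v) = shift i p j (- q - pairing j v - c j i * p) v"
  using reflect_shift[OF assms(2,1)] by (simp add: shift_commute[of i])

lemma shift_trivial: "p = 0 \<Longrightarrow> q = 0 \<Longrightarrow> shift i p j q v = v"
  by (simp add: shift_def)

fun act :: "nat list \<Rightarrow> (nat \<Rightarrow> 'r) \<Rightarrow> nat \<Rightarrow> 'r" where
  "act [] v = v"
| "act (i # u) v = reflect i (act u v)"

lemma act_append: "act (u @ u') v = act u (act u' v)"
  by (induction u) auto

lemma reflect_reflect: "i \<in> S \<Longrightarrow> reflect i (reflect i v) = v"
proof -
  assume i: "i \<in> S"
  have "reflect i v = shift i (- pairing i v) i 0 v"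
    by (auto simp: reflect_def shift_def)
  then show ?thesis
    using i by (simp add: reflect_def pairing_shift diag_S) (auto simp: shift_def fun_eq_iff)
qed

lemma act_braid:
  assumes ij: "i \<in> S" "j \<in> S"
  shows "act (concat (replicate (m i j) [i, j])) v = v"
proof (cases "i = j")
  case True
  then have "m i j = 1"
    using matrix ij by (auto simp: coxeter_matrix_def S_def)
  then show ?thesis
    using True ij by (simp add: reflect_reflect)
next
  case False
  have start: "act (concat (replicate (m i j) [i, j])) v =
      act (concat (replicate (m i j) [i, j])) (shift i 0 j 0 v)"
    by (simp add: shift_trivial)
  have b: "bond (m i j) (c i j) (c j i)"
    using bond ij False by (simp add: S_def)
  consider (two) "m i j = 2" "c i j = 0" "c j i = 0"
    | (three) "m i j = 3" "c i j = - 1" "c j i = - 1"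
    | (four) "m i j = 4" "c i j = - 1" "c j i = - 2"
    | (four') "m i j = 4" "c i j = - 2" "c j i = - 1"
    | (five) "m i j = 5" "c i j = c j i" "c j i * c j i = 1 - c j i"
    using b unfolding bond_def by metis
  then show ?thesis
  proof cases
    case two
    then show ?thesis
      unfolding start using ij
      by (simp only: numeral_eq_Suc pred_numeral_simps replicate.simps concat.simps append.simps act.simps
          reflect_shift reflect_shift' BitM.simps One_nat_def)
        (rule shift_trivial; simp add: algebra_simps)
  next
    case three
    then show ?thesis
      unfolding start using ij
      by (simp only: numeral_eq_Suc pred_numeral_simps replicate.simps concat.simps append.simps act.simps
          reflect_shift reflect_shift' BitM.simps One_nat_def)
        (rule shift_trivial; simp add: algebra_simps)
  next
    case four
    then show ?thesis
      unfolding start using ij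
      by (simp only: numeral_eq_Suc pred_numeral_simps replicate.simps concat.simps append.simps act.simps
          reflect_shift reflect_shift' BitM.simps One_nat_def)
        (rule shift_trivial; simp add: algebra_simps)
  next
    case four'
    then show ?thesis
      unfolding start using ij
      by (simp only: numeral_eq_Suc pred_numeral_simps replicate.simps concat.simps append.simps act.simps
          reflect_shift reflect_shift' BitM.simps One_nat_def)
        (rule shift_trivial; simp add: algebra_simps)
  next
    case five
    \<comment> \<open>The equation of the golden ratio for \<open>- c j i\<close>; the second form
      applies inside products that are associated to the right.\<close>
    have square: "c j i * c j i = 1 - c j i" "c j i * (c j i * z) = z - c j i * z" for z
      using five(3) by (simp, metis (no_types, lifting) left_diff_distrib mult.assoc mult_1)
    show ?thesis
      unfolding start using ij five(1,2)
      by (simp only: numeral_eq_Suc pred_numeral_simps replicate.simps concat.simps append.simps act.simps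
          reflect_shift reflect_shift' BitM.simps One_nat_def)
        (rule shift_trivial; simp add: algebra_simps square)
  qed
qed


lemma act_congruence: "coxeter_congruence n m u u' \<Longrightarrow> act u v = act u' v"
  by (induction rule: coxeter_congruence.induct) (auto simp: act_append act_braid S_def)

text \<open>Relators have length \<open>2 * m i j\<close>. This is the sign character at the level
  of words; it excludes that multiplication by a generator preserves the length.\<close>

lemma even_length_congruence: "coxeter_congruence n m u u' \<Longrightarrow> even (length u) = even (length u')"
proof (induction rule: coxeter_congruence.induct)
  case (relator i j u v)
  have "length (concat (replicate k [i, j])) = 2 * k" for k
    by (induction k) auto
  then show ?case by simp
qed auto

section \<open>Words and lengths\<close>

lemma val_Nil [simp]: "val [] = \<one>"
  and val_Cons [simp]: "val (i # u) = s i \<otimes> val u"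
  by (simp_all add: word_value_def)

lemma generator_in_carrier [simp]: "i \<in> S \<Longrightarrow> s i \<in> carrier W"
  using generator_closed by (simp add: S_def)

lemma val_closed [simp]: "u \<in> lists S \<Longrightarrow> val u \<in> carrier W"
  by (induction u) auto

lemma val_append: "u \<in> lists S \<Longrightarrow> u' \<in> lists S \<Longrightarrow> val (u @ u') = val u \<otimes> val u'"
  by (induction u) (auto simp: m_assoc)

lemma generator_square [simp]: "i \<in> S \<Longrightarrow> s i \<otimes> s i = \<one>"
  using relations[of i i] matrix by (simp add: coxeter_matrix_def S_def)

lemma inv_generator [simp]: "i \<in> S \<Longrightarrow> inv (s i) = s i"
  by (simp add: inv_equality)

lemma mult_generator_twice [simp]: "i \<in> S \<Longrightarrow> w \<in> carrier W \<Longrightarrow> w \<otimes> s i \<otimes> s i = w"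
  by (simp add: m_assoc)

lemma inv_val: "u \<in> lists S \<Longrightarrow> inv (val u) = val (rev u)"
  by (induction u) (auto simp: inv_mult_group val_append in_lists_conv_set)

lemma generate_eq_val:
  assumes "I \<subseteq> S"
  shows "generate W (s ` I) = val ` lists I"
proof (intro equalityI subsetI)
  fix w assume "w \<in> generate W (s ` I)"
  then show "w \<in> val ` lists I"
  proof (induction rule: generate.induct)
    case one
    then show ?case by (auto intro!: image_eqI[of _ _ "[]"])
  next
    case (incl h)
    then obtain i where "i \<in> I" "h = s i" by auto
    then show ?case
      using assms by (auto intro!: image_eqI[of _ _ "[i]"] simp: subset_iff)
  next
    case (inv h)
    then obtain i where "i \<in> I" "h = s i" by auto
    then show ?case
      using assms by (auto intro!: image_eqI[of _ _ "[i]"] simp: subset_iff)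
  next
    case (eng h1 h2)
    then obtain u1 u2 where "u1 \<in> lists I" "h1 = val u1" "u2 \<in> lists I" "h2 = val u2" by auto
    moreover from this have "u1 \<in> lists S" "u2 \<in> lists S" using assms by auto
    ultimately show ?case
      by (intro image_eqI[of _ _ "u1 @ u2"]) (simp_all add: val_append)
  qed
next
  fix w assume "w \<in> val ` lists I"
  then obtain u where "u \<in> lists I" "w = val u" by auto
  then show "w \<in> generate W (s ` I)"
  proof (induction u arbitrary: w)
    case (Cons i u)
    then have "s i \<in> generate W (s ` I)" "val u \<in> generate W (s ` I)"
      by (auto intro: generate.incl)
    with Cons show ?case by (simp add: generate.eng)
  qed (simp add: generate.one)
qed

lemma parabolic_eq: "I \<subseteq> S \<Longrightarrow> parabolic W s I = val ` lists I"
  by (simp add: parabolic_def generate_eq_val)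

lemma parabolic_S: "parabolic W s S = carrier W"
  by (simp add: parabolic_def generated S_def)

lemma exists_word: "w \<in> carrier W \<Longrightarrow> \<exists>u\<in>lists S. val u = w"
  using generate_eq_val[of S] generated by (auto simp: S_def)

lemma len_val_le: "u \<in> lists S \<Longrightarrow> len (val u) \<le> length u"
  unfolding coxeter_length_def by (rule Least_le) (auto simp: S_def)

lemma reduced_word:
  assumes "w \<in> carrier W"
  obtains u where "u \<in> lists S" "length u = len w" "val u = w"
proof -
  have "\<exists>k. \<exists>u\<in>lists S. length u = k \<and> val u = w"
    using exists_word[OF assms] by auto
  from LeastI_ex[OF this] show ?thesis
    using that unfolding coxeter_length_def S_def by auto
qed

lemma len_mult:
  assumes "x \<in> carrier W" "y \<in> carrier W"
  shows "len (x \<otimes> y) \<le> len x + len y"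
proof -
  obtain u where u: "u \<in> lists S" "length u = len x" "val u = x" using reduced_word[OF assms(1)] .
  obtain u' where u': "u' \<in> lists S" "length u' = len y" "val u' = y" using reduced_word[OF assms(2)] .
  have "len (val (u @ u')) \<le> length (u @ u')"
    using u u' by (intro len_val_le) auto
  then show ?thesis using u u' by (simp add: val_append)
qed

lemma len_inv_le: "w \<in> carrier W \<Longrightarrow> len (inv w) \<le> len w"
proof -
  assume "w \<in> carrier W"
  then obtain u where u: "u \<in> lists S" "length u = len w" "val u = w" by (rule reduced_word)
  have "len (val (rev u)) \<le> length (rev u)"
    using u by (intro len_val_le) auto
  then show ?thesis using u inv_val[of u] by simp
qed

lemma len_inv [simp]: "w \<in> carrier W \<Longrightarrow> len (inv w) = len w"
  using len_inv_le[of w] len_inv_le[of "inv w"] by simp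

lemma len_one [simp]: "len \<one> = 0"
  using len_val_le[of "[]"] by simp

lemma len_eq_0: "w \<in> carrier W \<Longrightarrow> len w = 0 \<Longrightarrow> w = \<one>"
  by (rule reduced_word[of w]) auto

lemma len_mult_generator:
  assumes "w \<in> carrier W" "i \<in> S"
  shows "len (w \<otimes> s i) = len w + 1 \<or> len w = len (w \<otimes> s i) + 1"
proof -
  have closed: "w \<otimes> s i \<in> carrier W" using assms by auto
  have "len (s i) \<le> 1"
    using len_val_le[of "[i]"] assms by simp
  then have "len (w \<otimes> s i) \<le> len w + 1" "len w \<le> len (w \<otimes> s i) + 1"
    using len_mult[OF assms(1) generator_in_carrier[OF assms(2)]]
      len_mult[OF closed generator_in_carrier[OF assms(2)]] assms by simp_all
  moreover have "len (w \<otimes> s i) \<noteq> len w"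
  proof -
    obtain u where u: "u \<in> lists S" "length u = len w" "val u = w"
      using reduced_word[OF assms(1)] .
    obtain u' where u': "u' \<in> lists S" "length u' = len (w \<otimes> s i)" "val u' = w \<otimes> s i"
      using reduced_word[OF closed] .
    have "coxeter_congruence n m (u @ [i]) u'"
      using u u' assms by (intro presented) (auto simp: val_append S_def)
    from even_length_congruence[OF this] show ?thesis
      using u u' by auto
  qed
  ultimately show ?thesis by linarith
qed

lemma len_mult_generator_less: "w \<in> carrier W \<Longrightarrow> i \<in> S \<Longrightarrow>
    len (w \<otimes> s i) < len w \<longleftrightarrow> len w = len (w \<otimes> s i) + 1"
  using len_mult_generator by fastforce

lemma exists_descent:
  assumes "w \<in> carrier W" "w \<noteq> \<one>"
  obtains i where "i \<in> S" "len (w \<otimes> s i) < len w"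
proof -
  obtain u where u: "u \<in> lists S" "length u = len w" "val u = w"
    using reduced_word[OF assms(1)] .
  then obtain u' i where ui: "u = u' @ [i]"
    using assms(2) by (cases u rule: rev_cases) auto
  have "val u' \<otimes> s i \<otimes> s i = val u'"
    using u ui by (intro mult_generator_twice) auto
  with u ui have "w \<otimes> s i = val u'"
    by (auto simp: val_append)
  moreover have "len (val u') \<le> length u'"
    using u ui by (intro len_val_le) auto
  ultimately show ?thesis using u ui that by auto
qed

section \<open>The linear action of the group and its roots\<close>

definition action :: "'a \<Rightarrow> (nat \<Rightarrow> 'r) \<Rightarrow> nat \<Rightarrow> 'r" where
  "action w = act (SOME u. u \<in> lists S \<and> val u = w)"

text \<open>Here the presentation enters: words of equal value are congruent, and congruent words
  act equally, so the chosen word is immaterial.\<close>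

lemma action_val: "u \<in> lists S \<Longrightarrow> action (val u) = act u"
proof -
  assume u: "u \<in> lists S"
  let ?u = "SOME u'. u' \<in> lists S \<and> val u' = val u"
  have "?u \<in> lists S \<and> val ?u = val u"
    by (rule someI[of _ u]) (use u in simp)
  then have "coxeter_congruence n m ?u u"
    using u by (intro presented) (auto simp: S_def)
  then show ?thesis
    unfolding action_def using act_congruence by auto
qed

lemma action_one [simp]: "action \<one> v = v"
  using action_val[of "[]"] by simp

lemma action_generator [simp]: "i \<in> S \<Longrightarrow> action (s i) = reflect i"
  using action_val[of "[i]"] by auto

lemma action_mult:
  assumes "x \<in> carrier W" "y \<in> carrier W"
  shows "action (x \<otimes> y) v = action x (action y v)"
proof -
  obtain u where u: "u \<in> lists S" "val u = x" using exists_word[OF assms(1)] by auto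
  obtain u' where u': "u' \<in> lists S" "val u' = y" using exists_word[OF assms(2)] by auto
  have "action (val (u @ u')) v = act (u @ u') v"
    using u u' by (subst action_val) auto
  then show ?thesis
    using u u' action_val[of u] action_val[of u'] by (simp add: val_append act_append)
qed

lemma action_inv [simp]:
  "w \<in> carrier W \<Longrightarrow> action (inv w) (action w v) = v"
  "w \<in> carrier W \<Longrightarrow> action w (action (inv w) v) = v"
  by (simp_all flip: action_mult)

lemma reflect_linear:
  "reflect i (\<lambda>l. a * x l + b * y l) = (\<lambda>l. a * reflect i x l + b * reflect i y l)"
proof -
  have "pairing i (\<lambda>l. a * x l + b * y l) = a * pairing i x + b * pairing i y"
    by (simp add: pairing_def sum_distrib_left sum.distrib algebra_simps)
  then show ?thesis
    by (auto simp: reflect_def fun_eq_iff algebra_simps)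
qed

lemma act_linear:
  "act u (\<lambda>l. a * x l + b * y l) = (\<lambda>l. a * act u x l + b * act u y l)"
  by (induction u) (simp_all add: reflect_linear)

lemma action_linear:
  "action w (\<lambda>l. a * x l + b * y l) = (\<lambda>l. a * action w x l + b * action w y l)"
  by (simp add: action_def act_linear)

lemma action_zero: "action w (\<lambda>_. 0) = (\<lambda>_. 0)"
  using action_linear[of w 0 "\<lambda>_. 0" 0 "\<lambda>_. 0"] by simp

lemma action_scale: "action w (\<lambda>l. a * x l) = (\<lambda>l. a * action w x l)"
  using action_linear[of w a x 0 x] by simp

definition simple :: "nat \<Rightarrow> nat \<Rightarrow> 'r" where
  "simple j = (\<lambda>l. if l = j then 1 else 0)"

definition root :: "'a \<Rightarrow> nat \<Rightarrow> nat \<Rightarrow> 'r" where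
  "root w j = action w (simple j)"

lemma action_expand:
  assumes "finite I" "\<And>l. l \<notin> I \<Longrightarrow> v l = 0"
  shows "action w v = (\<lambda>l. \<Sum>i\<in>I. v i * root w i l)"
proof -
  have "action w (\<lambda>l. if l \<in> I then v l else 0) = (\<lambda>l. \<Sum>i\<in>I. v i * root w i l)"
    using assms(1)
  proof (induction I)
    case (insert j I)
    have "(\<lambda>l. if l \<in> insert j I then v l else 0) =
        (\<lambda>l. v j * simple j l + 1 * (if l \<in> I then v l else 0))"
      using insert.hyps by (auto simp: simple_def)
    then have "action w (\<lambda>l. if l \<in> insert j I then v l else 0) =
        (\<lambda>l. v j * root w j l + 1 * action w (\<lambda>l. if l \<in> I then v l else 0) l)"
      by (simp only: action_linear root_def)
    then show ?case using insert by simp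
  qed (simp add: action_zero)
  moreover have "(\<lambda>l. if l \<in> I then v l else 0) = v"
    using assms(2) by auto
  ultimately show ?thesis by simp
qed

lemma pairing_simple: "j \<in> S \<Longrightarrow> pairing i (simple j) = c i j"
  by (simp add: pairing_def simple_def if_distrib cong: if_cong)

lemma reflect_simple:
  "j \<in> S \<Longrightarrow> reflect i (simple j) = (\<lambda>l. 1 * simple j l + (- c i j) * simple i l)"
  by (auto simp: reflect_def pairing_simple) (auto simp: simple_def)

lemma root_one [simp]: "root \<one> j = simple j"
  by (simp add: root_def)

lemma root_mult: "x \<in> carrier W \<Longrightarrow> y \<in> carrier W \<Longrightarrow> root (x \<otimes> y) j = action x (root y j)"
  by (simp add: root_def action_mult)

lemma root_mult_generator:
  assumes "w \<in> carrier W" "i \<in> S" "j \<in> S"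
  shows "root (w \<otimes> s i) j l = root w j l - c i j * root w i l"
  using assms by (simp only: root_def action_mult generator_in_carrier action_generator reflect_simple
      action_linear) simp

lemma root_mult_generator_same:
  "w \<in> carrier W \<Longrightarrow> i \<in> S \<Longrightarrow> root (w \<otimes> s i) i l = - root w i l"
  by (simp add: root_mult_generator diag_S)

lemma root_nonzero:
  assumes "w \<in> carrier W"
  shows "root w j \<noteq> (\<lambda>_. 0)"
proof
  assume "root w j = (\<lambda>_. 0)"
  then have "action (inv w) (root w j) j = 0"
    by (simp add: action_zero)
  then show False
    using assms by (simp add: root_def simple_def)
qed

end

section \<open>Subgroups of rank two and the signs of roots\<close>

fun alternating :: "'x \<Rightarrow> 'x \<Rightarrow> nat \<Rightarrow> 'x list" where
  "alternating p q 0 = []"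
| "alternating p q (Suc k) = alternating q p k @ [q]"

lemma alternating_add: "\<exists>z\<in>lists {p, q}. alternating p q (a + b) = z @ alternating p q b"
proof (induction b arbitrary: p q)
  case 0
  have "alternating p q a \<in> lists {p, q}" for p q :: 'a
    by (induction p q a rule: alternating.induct) auto
  then show ?case by auto
next
  case (Suc b)
  from Suc[of q p] show ?case by (auto simp: insert_commute)
qed

text \<open>Letters are peeled off from the right, the end from which \<open>alternating\<close> is
  built: the last letter decides about right descents and is the first to act on a vector.\<close>

lemma eq_alternating:
  assumes "x \<in> lists {p, q}" "\<And>y i z. x \<noteq> y @ [i, i] @ z" "\<And>y. x \<noteq> y @ [p]"
  shows "x = alternating p q (length x)"
  using assms
proof (induction x arbitrary: p q rule: rev_induct)
  case (snoc a x)
  then have a: "a = q" by auto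
  have "x = alternating q p (length x)"
  proof (rule snoc.IH)
    show "x \<in> lists {q, p}" using snoc.prems(1) by auto
    show "x \<noteq> y @ [i, i] @ z" for y i z
      using snoc.prems(2)[of y i "z @ [a]"] by auto
    show "x \<noteq> y @ [q]" for y
      using snoc.prems(2)[of y q "[]"] a by auto
  qed
  then show ?case by (simp add: a)
qed simp

definition nonneg :: "(nat \<Rightarrow> 'r::cone_ring) \<Rightarrow> bool" where
  "nonneg v \<longleftrightarrow> (\<forall>l. 0 \<le> v l)"

definition nonpos :: "(nat \<Rightarrow> 'r::cone_ring) \<Rightarrow> bool" where
  "nonpos v \<longleftrightarrow> (\<forall>l. v l \<le> 0)"

context geometric_coxeter_system
begin

lemma bond_cases:
  assumes "p \<in> S" "q \<in> S" "p \<noteq> q"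
  obtains (two) "m p q = 2" "c p q = 0" "c q p = 0"
    | (three) "m p q = 3" "c p q = - 1" "c q p = - 1"
    | (four) "m p q = 4" "c p q = - 1" "c q p = - 2"
    | (four') "m p q = 4" "c p q = - 2" "c q p = - 1"
    | (five) "m p q = 5" "c p q = c q p" "c q p \<le> 0" "c q p * c q p = 1 - c q p"
proof -
  have "bond (m p q) (c p q) (c q p)"
    using bond assms by (simp add: S_def)
  then show ?thesis
    using that unfolding bond_def by metis
qed

text \<open>The relator of length \<open>2 * m p q\<close> is cut in the middle; taking the second
  half to the other side reverses it, since generators are involutions.\<close>

lemma val_braid:
  assumes pq: "p \<in> S" "q \<in> S" "p \<noteq> q"
  shows "val (alternating p q (m p q)) = val (alternating q p (m p q))"
proof -
  have words: "val (concat (replicate k [p, q])) = (s p \<otimes> s q) [^] k" for k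
  proof (induction k)
    case (Suc k)
    have "val (concat (replicate k [p, q])) \<in> carrier W"
      using pq by (intro val_closed) (auto split: if_splits)
    moreover have "(s p \<otimes> s q) [^] Suc k = s p \<otimes> s q \<otimes> (s p \<otimes> s q) [^] k"
      using pq by (intro nat_pow_Suc2) simp
    ultimately show ?case
      using Suc pq by (simp add: m_assoc del: nat_pow_Suc)
  qed simp
  have relation: "val (concat (replicate (m p q) [p, q])) = \<one>"
    using relations[of p q] pq by (simp add: words S_def)
  have split: "val u = val (rev u')"
    if "val (u @ u') = \<one>" "u \<in> lists S" "u' \<in> lists S" for u u'
    using that by (metis inv_equality inv_val val_append val_closed)
  from pq show ?thesis
  proof (cases rule: bond_cases)
    case two
    then show ?thesis
      using split[of "[p, q]" "[p, q]"] relation pq by (simp add: numeral_eq_Suc)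
  next
    case three
    then show ?thesis
      using split[of "[p, q, p]" "[q, p, q]"] relation pq by (simp add: numeral_eq_Suc)
  next
    case four
    then show ?thesis
      using split[of "[p, q, p, q]" "[p, q, p, q]"] relation pq by (simp add: numeral_eq_Suc)
  next
    case four'
    then show ?thesis
      using split[of "[p, q, p, q]" "[p, q, p, q]"] relation pq by (simp add: numeral_eq_Suc)
  next
    case five
    then show ?thesis
      using split[of "[p, q, p, q, p]" "[q, p, q, p, q]"] relation pq by (simp add: numeral_eq_Suc)
  qed
qed

text \<open>For each bond the orbit of \<open>simple j\<close> under the growing word is listed
  explicitly; it stays in the positive cone for fewer than \<open>m j t\<close> letters. For bond 5
  the coefficient \<open>- c t j\<close> is the golden ratio.\<close>

lemma act_alternating_nonneg:
  assumes jt: "j \<in> S" "t \<in> S" "j \<noteq> t" and k: "k < m j t"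
  shows "\<exists>a b. 0 \<le> a \<and> 0 \<le> b \<and>
    act (alternating j t k) (simple j) = (\<lambda>l. a * simple j l + b * simple t l)"
proof -
  define comb where "comb a b = (\<lambda>l. a * simple j l + b * simple t l)" for a b
  have comb_shift: "comb a b = shift j a t b (\<lambda>_. 0)" for a b
    using jt by (auto simp: comb_def shift_def simple_def)
  have pairing_0: "pairing i (\<lambda>_. 0) = 0" for i
    by (simp add: pairing_def)
  have refl_j: "reflect j (comb a b) = comb (- a - c j t * b) b"
    and refl_t: "reflect t (comb a b) = comb a (- b - c t j * a)" for a b
    using jt by (simp_all add: comb_shift reflect_shift reflect_shift' pairing_0)
  have start: "simple j = comb 1 0"
    by (simp add: comb_def)
  have witness: "\<exists>a b. 0 \<le> a \<and> 0 \<le> b \<and> act (alternating j t k) (simple j) = comb a b"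
    if "act (alternating j t k) (simple j) = comb a b" "0 \<le> a" "0 \<le> b" for a b
    using that by blast
  have zero_le: "(0::'r) \<le> 1" "(0::'r) \<le> 2"
    using add_nonneg_nonneg[of "1::'r" 1] zero_less_one[where 'a='r] by (simp_all add: less_imp_le)
  have "\<exists>a b. 0 \<le> a \<and> 0 \<le> b \<and> act (alternating j t k) (simple j) = comb a b"
    using jt
  proof (cases rule: bond_cases)
    case two
    from two k have "k = 0 \<or> k = 1" by auto
    then have "act (alternating j t k) (simple j) = comb 1 0"
      using two by (elim disjE) (simp_all add: start refl_j refl_t eval_nat_numeral)
    then show ?thesis using witness zero_le by auto
  next
    case three
    from three k have "k = 0 \<or> k = 1 \<or> k = 2" by auto
    then have "act (alternating j t k) (simple j) = comb 1 0
      \<or> act (alternating j t k) (simple j) = comb 1 1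
      \<or> act (alternating j t k) (simple j) = comb 0 1"
      using three by (elim disjE) (simp_all add: start refl_j refl_t eval_nat_numeral)
    then show ?thesis using witness zero_le by auto
  next
    case four
    from four k have "k = 0 \<or> k = 1 \<or> k = 2 \<or> k = 3" by auto
    then have "act (alternating j t k) (simple j) = comb 1 0
      \<or> act (alternating j t k) (simple j) = comb 1 2"
      using four by (elim disjE) (simp_all add: start refl_j refl_t eval_nat_numeral)
    then show ?thesis using witness zero_le by auto
  next
    case four'
    from four' k have "k = 0 \<or> k = 1 \<or> k = 2 \<or> k = 3" by auto
    then have "act (alternating j t k) (simple j) = comb 1 0
      \<or> act (alternating j t k) (simple j) = comb 1 1"
      using four' by (elim disjE) (simp_all add: start refl_j refl_t eval_nat_numeral)
    then show ?thesis using witness zero_le by auto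
  next
    case five
    from five k have "k = 0 \<or> k = 1 \<or> k = 2 \<or> k = 3 \<or> k = 4" by auto
    then have "act (alternating j t k) (simple j) = comb 1 0
      \<or> act (alternating j t k) (simple j) = comb 1 (- c t j)
      \<or> act (alternating j t k) (simple j) = comb (- c t j) (- c t j)
      \<or> act (alternating j t k) (simple j) = comb (- c t j) 1
      \<or> act (alternating j t k) (simple j) = comb 0 1"
      using five(2,4) by (elim disjE) (simp_all add: start refl_j refl_t eval_nat_numeral)
    then show ?thesis using witness zero_le five(3) by auto
  qed
  then show ?thesis by (simp add: comb_def)
qed

text \<open>Write \<open>w = v x\<close> with \<open>x\<close> a word in \<open>j\<close> and a right descent \<open>t\<close> of \<open>w\<close>, lengths
  adding up and \<open>v\<close> as short as possible. Then \<open>v\<close> has neither descent, so induction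
  applies to it, and \<open>x\<close> is alternating, ends in \<open>t\<close> and is shorter than \<open>m j t\<close>, so it
  sends \<open>\<alpha>\<^sub>j\<close> to a nonnegative combination of \<open>\<alpha>\<^sub>j\<close> and \<open>\<alpha>\<^sub>t\<close>.\<close>

theorem root_nonneg:
  assumes "w \<in> carrier W" "j \<in> S" "\<not> len (w \<otimes> s j) < len w"
  shows "nonneg (root w j)"
  using assms
proof (induction "len w" arbitrary: w j rule: less_induct)
  case less
  note w = less.prems(1) and j = less.prems(2)
  show ?case
  proof (cases "w = \<one>")
    case True
    then show ?thesis by (simp add: nonneg_def simple_def)
  next
    case False
    then obtain t where t: "t \<in> S" "len (w \<otimes> s t) < len w"
      using exists_descent w by blast
    with less.prems have jt: "j \<noteq> t" by auto
    define Q where "Q v x \<longleftrightarrow> v \<in> carrier W \<and> x \<in> lists {j, t} \<and> w = v \<otimes> val x \<and>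
      len w = len v + length x" for v x
    have listsS: "x \<in> lists S" if "x \<in> lists {j, t}" for x
      using that j t by auto
    \<comment> \<open>This factorization shows that the family is nonempty and bounds its minimum,
      so \<open>v\<close> is shorter than \<open>w\<close> and the induction hypothesis applies to
      it.\<close>
    have "Q (w \<otimes> s t) [t]"
      using w t len_mult_generator[of w t] by (auto simp: Q_def)
    moreover from this obtain v where least: "\<exists>x. Q v x" "\<And>v' x. Q v' x \<Longrightarrow> len v \<le> len v'"
      using ex_has_least_nat[of "\<lambda>v. \<exists>x. Q v x" _ len] by blast
    ultimately have shorter: "len v < len w"
      using t(2) by fastforce
    obtain x where Qx: "Q v x" using least(1) by blast
    then have v: "v \<in> carrier W" and x: "x \<in> lists {j, t}" "x \<in> lists S"
      using listsS by (auto simp: Q_def)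
    have no_descent: "\<not> len (v \<otimes> s i) < len v" if i: "i \<in> {j, t}" for i
    proof
      assume less: "len (v \<otimes> s i) < len v"
      have iS: "i \<in> S" using i j t by auto
      have "v \<otimes> s i \<otimes> (s i \<otimes> val x) = v \<otimes> val x"
        using iS v x by (simp flip: m_assoc)
      then have "Q (v \<otimes> s i) (i # x)"
        using Qx less len_mult_generator_less[of v i] iS i v x by (auto simp: Q_def)
      then show False using least(2) less by fastforce
    qed
    have word_short: "length x \<le> length x'"
      if "x' \<in> lists S" "w = v \<otimes> val x'" for x'
    proof -
      have "len (v \<otimes> val x') \<le> len v + length x'"
        using len_mult[of v "val x'"] v len_val_le[of x'] that(1) by simp
      then have "len w \<le> len v + length x'"
        using that(2) by simp
      then show ?thesis
        using Qx unfolding Q_def by linarith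
    qed
    \<comment> \<open>Needed for all words \<open>x'\<close> and not only for \<open>x\<close>,
      because it is applied again after a braid move.\<close>
    have not_j: "x' \<noteq> y @ [j]" if x': "Q v x'" for x' y
    proof
      assume y: "x' = y @ [j]"
      then have yS: "y \<in> lists S" using x' listsS[of x'] by (auto simp: Q_def)
      then have "w \<otimes> s j = v \<otimes> val y"
        using x' y v j by (simp add: Q_def val_append flip: m_assoc)
      then have "len (w \<otimes> s j) \<le> len v + length y"
        using len_mult[of v "val y"] len_val_le[of y] v yS by simp
      then show False using less.prems(3) x' y by (simp add: Q_def)
    qed
    have no_repeat: "x \<noteq> y @ [i, i] @ z" for y i z
    proof
      assume eq: "x = y @ [i, i] @ z"
      then have mem: "y \<in> lists S" "i \<in> S" "z \<in> lists S" using x by auto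
      then have "val x = val (y @ z)"
        by (simp add: eq val_append) (simp flip: m_assoc)
      then have "length x \<le> length (y @ z)"
        using Qx mem by (intro word_short) (auto simp: Q_def)
      then show False by (simp add: eq)
    qed
    have alt: "x = alternating j t (length x)"
      using eq_alternating[OF x(1) no_repeat] not_j[OF Qx] by blast
    \<comment> \<open>Otherwise \<open>x\<close> ends in a full braid word. Exchanging it for the
      other one gives a factorization of \<open>w\<close> whose last letter is \<open>j\<close>,
      which \<open>not_j\<close> forbids.\<close>
    have "length x < m j t"
    proof (rule ccontr)
      assume "\<not> length x < m j t"
      then obtain z where z: "z \<in> lists {j, t}" "x = z @ alternating j t (m j t)"
        using alternating_add[of j t "length x - m j t" "m j t"] alt by auto
      have alt_lists: "alternating t j k \<in> lists {j, t}" "alternating j t k \<in> lists {j, t}"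
        "length (alternating t j k) = k" "length (alternating j t k) = k" for k
        by (induction k) auto
      have "Q v (z @ alternating t j (m j t))"
        using Qx z alt_lists val_braid[OF j t(1) jt] listsS
        by (auto simp: Q_def val_append)
      moreover obtain k where "m j t = Suc k"
        using j t(1) jt by (cases rule: bond_cases) (auto simp: numeral_eq_Suc)
      ultimately show False
        using not_j[of "z @ alternating t j (m j t)" "z @ alternating j t k"] by simp
    qed
    then obtain a b where ab: "0 \<le> a" "0 \<le> b"
      "act x (simple j) = (\<lambda>l. a * simple j l + b * simple t l)"
      using act_alternating_nonneg[OF j t(1) jt] alt by metis
    have "root w j = (\<lambda>l. a * root v j l + b * root v t l)"
      using Qx v x by (simp add: Q_def root_mult) (simp add: root_def action_val ab action_linear)
    moreover have "nonneg (root v j)" "nonneg (root v t)"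
      using less.hyps[OF shorter v] no_descent j t by auto
    ultimately show ?thesis
      using ab by (simp add: nonneg_def add_nonneg_nonneg cone_mult_nonneg)
  qed
qed

lemma root_not_both:
  assumes "w \<in> carrier W" "nonneg (root w j)" "nonpos (root w j)"
  shows False
  using assms root_nonzero[of w j] unfolding nonneg_def nonpos_def fun_eq_iff
  by (meson order_antisym)

lemma root_nonpos:
  assumes "w \<in> carrier W" "j \<in> S" "len (w \<otimes> s j) < len w"
  shows "nonpos (root w j)"
  using root_nonneg[of "w \<otimes> s j" j] assms
  by (simp add: nonneg_def nonpos_def root_mult_generator_same)

lemma nonpos_root_iff:
  "w \<in> carrier W \<Longrightarrow> j \<in> S \<Longrightarrow> nonpos (root w j) \<longleftrightarrow> len (w \<otimes> s j) < len w"
  using root_nonneg root_nonpos root_not_both by blast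

lemma nonneg_root_iff:
  "w \<in> carrier W \<Longrightarrow> j \<in> S \<Longrightarrow> nonneg (root w j) \<longleftrightarrow> \<not> len (w \<otimes> s j) < len w"
  using root_nonneg root_nonpos root_not_both by blast

lemma root_cases: "w \<in> carrier W \<Longrightarrow> j \<in> S \<Longrightarrow> nonneg (root w j) \<or> nonpos (root w j)"
  using root_nonneg root_nonpos by blast


subsection \<open>Cosets of parabolic subgroups\<close>

lemma subgroup_parabolic: "I \<subseteq> S \<Longrightarrow> subgroup (parabolic W s I) W"
  unfolding parabolic_def by (intro generate_is_subgroup) auto

lemma parabolic_closed [simp]: "u \<in> parabolic W s I \<Longrightarrow> I \<subseteq> S \<Longrightarrow> u \<in> carrier W"
  using subgroup.mem_carrier[OF subgroup_parabolic] .

lemma parabolic_mult: "I \<subseteq> S \<Longrightarrow> x \<in> parabolic W s I \<Longrightarrow> y \<in> parabolic W s I \<Longrightarrow>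
    x \<otimes> y \<in> parabolic W s I"
  using subgroup.m_closed[OF subgroup_parabolic] .

lemma parabolic_inv: "I \<subseteq> S \<Longrightarrow> x \<in> parabolic W s I \<Longrightarrow> inv x \<in> parabolic W s I"
  using subgroup.m_inv_closed[OF subgroup_parabolic] .

lemma parabolic_one [simp]: "\<one> \<in> parabolic W s I"
  by (simp add: parabolic_def generate.one)

lemma parabolic_generator: "i \<in> I \<Longrightarrow> s i \<in> parabolic W s I"
  by (simp add: parabolic_def generate.incl)

lemma parabolic_mono: "I \<subseteq> J \<Longrightarrow> parabolic W s I \<subseteq> parabolic W s J"
  unfolding parabolic_def by (intro mono_generate) auto

lemma action_outside:
  assumes "I \<subseteq> S" "u \<in> parabolic W s I" "l \<notin> I"
  shows "action u v l = v l"
proof -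
  obtain x where x: "x \<in> lists I" "u = val x"
    using assms by (auto simp: parabolic_eq)
  have "act x v l = v l"
    using x(1) assms(3) by (induction x) (auto simp: reflect_def)
  moreover have "action u = act x"
    using x assms(1) by (auto intro: action_val)
  ultimately show ?thesis by simp
qed

lemma root_outside:
  "I \<subseteq> S \<Longrightarrow> u \<in> parabolic W s I \<Longrightarrow> i \<in> I \<Longrightarrow> l \<notin> I \<Longrightarrow> root u i l = 0"
  by (auto simp: root_def action_outside simple_def)

text \<open>Elements of the parabolic subgroup fix all coordinates outside \<open>I\<close>. For
  \<open>i \<notin> I\<close> the root \<open>root u i\<close> therefore keeps coordinate 1 at
  \<open>i\<close> and cannot be negative, so any descent lies in \<open>I\<close>.\<close>

lemma parabolic_descent:
  assumes "I \<subseteq> S" "u \<in> parabolic W s I" "u \<noteq> \<one>"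
  obtains i where "i \<in> I" "len (u \<otimes> s i) < len u"
proof -
  obtain i where i: "i \<in> S" "len (u \<otimes> s i) < len u"
    using exists_descent assms parabolic_closed by metis
  moreover have "i \<in> I"
  proof (rule ccontr)
    assume "i \<notin> I"
    then have "root u i i = 1"
      using assms by (simp add: root_def action_outside simple_def)
    moreover have "root u i i \<le> 0"
      using i assms root_nonpos by (auto simp: nonpos_def)
    ultimately show False
      using zero_less_one[where 'a='r] by (metis less_le_not_le)
  qed
  ultimately show ?thesis using that by blast
qed

text \<open>Having no right descent in \<open>K\<close> is phrased through signs of roots, so that
  products can be followed by linear algebra.\<close>

definition minimal_reps :: "nat set \<Rightarrow> 'a set" where
  "minimal_reps K = {w \<in> carrier W. \<forall>k\<in>K. nonneg (root w k)}"

lemma minimal_reps_cone: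
  assumes "v \<in> minimal_reps I" "I \<subseteq> S" "nonneg x" "\<And>l. l \<notin> I \<Longrightarrow> x l = 0"
  shows "nonneg (action v x)"
proof -
  have "finite I" using finite_subset[OF assms(2) finite_S] .
  then show ?thesis
    using assms unfolding nonneg_def
    by (auto simp: action_expand minimal_reps_def nonneg_def intro!: sum_nonneg cone_mult_nonneg)
qed

lemma nonpos_uminus: "nonpos x \<longleftrightarrow> nonneg (\<lambda>l. - x l)" for x :: "nat \<Rightarrow> 'r"
  by (simp add: nonneg_def nonpos_def)

text \<open>\<open>root u i\<close> is supported on \<open>I\<close>, and \<open>v\<close> maps the
  positive cone of \<open>I\<close> into the positive cone, hence also negatives to negatives. As no
  root has both signs, the sign is preserved both ways.\<close>

lemma nonneg_root_mult_iff:
  assumes I: "I \<subseteq> S" "i \<in> I" and v: "v \<in> minimal_reps I" and u: "u \<in> parabolic W s I"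
  shows "nonneg (root (v \<otimes> u) i) \<longleftrightarrow> nonneg (root u i)"
proof -
  have closed: "v \<in> carrier W" "u \<in> carrier W" "i \<in> S"
    using assms by (auto simp: minimal_reps_def)
  have zero: "root u i l = 0" if "l \<notin> I" for l
    using root_outside that assms by auto
  have "nonneg (root (v \<otimes> u) i)" if "nonneg (root u i)"
    using minimal_reps_cone[OF v I(1) that zero] closed by (simp add: root_mult)
  moreover have "nonpos (root (v \<otimes> u) i)" if "nonpos (root u i)"
  proof -
    have "nonneg (action v (\<lambda>l. - root u i l))"
      using that zero by (intro minimal_reps_cone[OF v I(1)]) (auto simp: nonpos_uminus)
    then show ?thesis
      using action_scale[of v "- 1" "root u i"] closed by (simp add: root_mult nonpos_uminus)
  qed
  ultimately show ?thesis
    using root_cases[of u i] root_not_both[of "v \<otimes> u" i] closed by blast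
qed

text \<open>\<open>u\<close> is built up letter by letter; by the transfer of signs, every letter
  that lengthens \<open>u\<close> also lengthens \<open>v \<otimes> u\<close>.\<close>

lemma len_mult_minimal_rep:
  assumes I: "I \<subseteq> S" and v: "v \<in> minimal_reps I" and u: "u \<in> parabolic W s I"
  shows "len (v \<otimes> u) = len v + len u"
  using u
proof (induction "len u" arbitrary: u rule: less_induct)
  case less
  have vc: "v \<in> carrier W" using v by (simp add: minimal_reps_def)
  show ?case
  proof (cases "u = \<one>")
    case False
    obtain i where i: "i \<in> I" "len (u \<otimes> s i) < len u"
      using parabolic_descent[OF I less.prems False] .
    define u' where "u' = u \<otimes> s i"
    have iS: "i \<in> S" and uc: "u \<in> carrier W" using i I less.prems by auto
    then have u: "u = u' \<otimes> s i" by (simp add: u'_def)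
    have u': "u' \<in> parabolic W s I"
      using less.prems i I by (auto simp: u'_def intro: parabolic_mult parabolic_generator)
    then have u'c: "u' \<in> carrier W" using I by simp
    have "len u = len u' + 1"
      using i iS uc len_mult_generator_less by (simp add: u'_def)
    moreover have "nonneg (root u' i)"
      unfolding nonneg_root_iff[OF u'c iS] u[symmetric] using i(2) by (simp add: u'_def)
    then have "nonneg (root (v \<otimes> u') i)"
      using nonneg_root_mult_iff[OF I i(1) v u'] by simp
    then have "len (v \<otimes> u' \<otimes> s i) = len (v \<otimes> u') + 1"
      using nonneg_root_iff[of "v \<otimes> u'" i] len_mult_generator[of "v \<otimes> u'" i] vc u'c iS by auto
    moreover have "v \<otimes> u = v \<otimes> u' \<otimes> s i"
      using vc u'c iS by (simp add: u m_assoc)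
    moreover have "len (v \<otimes> u') = len v + len u'"
      using less.hyps[OF _ u'] i by (simp add: u'_def)
    ultimately show ?thesis by simp
  qed (use vc in simp)
qed

lemma coset_decomposition:
  assumes "I \<subseteq> J" "J \<subseteq> S" "w \<in> parabolic W s J"
  shows "\<exists>v\<in>parabolic W s J \<inter> minimal_reps I. \<exists>u\<in>parabolic W s I. w = v \<otimes> u"
  using assms(3)
proof (induction "len w" arbitrary: w rule: less_induct)
  case less
  have wc: "w \<in> carrier W" using less.prems assms by simp
  show ?case
  proof (cases "w \<in> minimal_reps I")
    case True
    then show ?thesis
      using less.prems wc by (intro bexI[of _ w] bexI[of _ \<one>]) auto
  next
    case False
    then obtain i where i: "i \<in> I" "len (w \<otimes> s i) < len w"
      using wc assms nonneg_root_iff by (auto simp: minimal_reps_def subset_iff)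
    then have iS: "i \<in> S" using assms by auto
    have "w \<otimes> s i \<in> parabolic W s J"
      using less.prems i assms by (intro parabolic_mult parabolic_generator) auto
    then obtain v u where vu: "v \<in> parabolic W s J \<inter> minimal_reps I" "u \<in> parabolic W s I"
      "w \<otimes> s i = v \<otimes> u"
      using less.hyps i by blast
    have closed: "v \<in> carrier W" "u \<in> carrier W"
      using vu assms by (auto simp: minimal_reps_def)
    have "w = v \<otimes> u \<otimes> s i"
      using vu(3) wc iS mult_generator_twice by metis
    then have "w = v \<otimes> (u \<otimes> s i)"
      using closed iS by (simp add: m_assoc)
    moreover have "u \<otimes> s i \<in> parabolic W s I"
      using vu i assms by (intro parabolic_mult parabolic_generator) auto
    ultimately show ?thesis using vu by blast
  qed
qed

text \<open>Two minimal representatives of one coset differ by some \<open>y\<close> in the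
  parabolic subgroup. Additivity of length, used in both directions, forces
  \<open>len y = 0\<close>.\<close>

lemma coset_unique:
  assumes I: "I \<subseteq> S" and v: "v \<in> minimal_reps I" "v' \<in> minimal_reps I"
    and u: "u \<in> parabolic W s I" "u' \<in> parabolic W s I" and eq: "v \<otimes> u = v' \<otimes> u'"
  shows "v = v' \<and> u = u'"
proof -
  have closed: "v \<in> carrier W" "v' \<in> carrier W" "u \<in> carrier W" "u' \<in> carrier W"
    using assms by (auto simp: minimal_reps_def)
  define y where "y = u' \<otimes> inv u"
  have y: "y \<in> parabolic W s I" "inv y \<in> parabolic W s I" "y \<in> carrier W"
    using u I closed by (auto simp: y_def intro!: parabolic_mult parabolic_inv)
  have "v = v \<otimes> u \<otimes> inv u"
    using closed by (simp add: m_assoc)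
  then have vy: "v = v' \<otimes> y"
    using closed by (simp add: eq y_def m_assoc)
  then have v'y: "v' = v \<otimes> inv y"
    using closed y by (simp add: m_assoc)
  have "len v = len v' + len y"
    using len_mult_minimal_rep[OF I v(2) y(1)] by (simp flip: vy)
  moreover have "len v' = len v + len y"
    using len_mult_minimal_rep[OF I v(1) y(2)] y(3) by (simp flip: v'y)
  ultimately have "y = \<one>"
    using len_eq_0 y(3) by simp
  then have "v = v'"
    using closed by (simp add: vy)
  then show ?thesis
    using eq closed by simp
qed

section \<open>Length generating polynomials of quotients\<close>

definition quotient_reps :: "nat set \<Rightarrow> nat set \<Rightarrow> 'a set" where
  "quotient_reps J K = parabolic W s J \<inter> minimal_reps K"

lemma finite_quotient_reps [simp]: "finite (quotient_reps J K)"
  using finite_subset[OF _ finite_carrier] by (auto simp: quotient_reps_def minimal_reps_def)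

lemma one_in_quotient_reps [simp]: "\<one> \<in> quotient_reps J K"
  using zero_less_one[where 'a='r]
  by (auto simp: quotient_reps_def minimal_reps_def nonneg_def simple_def less_imp_le)

text \<open>Coset decomposition for \<open>I\<close>, refined to \<open>K\<close>: by the transfer
  of signs, whether \<open>v \<otimes> u\<close> is minimal for \<open>K\<close> depends on
  \<open>u\<close> alone.\<close>

lemma quotient_reps_bij:
  assumes "K \<subseteq> I" "I \<subseteq> J" "J \<subseteq> S"
  shows "bij_betw (\<lambda>(v, u). v \<otimes> u) (quotient_reps J I \<times> quotient_reps I K) (quotient_reps J K)"
proof -
  have IS: "I \<subseteq> S" using assms by auto
  have iff: "v \<otimes> u \<in> minimal_reps K \<longleftrightarrow> u \<in> minimal_reps K"
    if "v \<in> minimal_reps I" "u \<in> parabolic W s I" for v u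
    using that assms IS nonneg_root_mult_iff[OF IS _ that]
    by (auto simp: minimal_reps_def subset_iff)
  show ?thesis
    unfolding bij_betw_def
  proof (intro conjI equalityI subsetI)
    show "inj_on (\<lambda>(v, u). v \<otimes> u) (quotient_reps J I \<times> quotient_reps I K)"
    proof (rule inj_onI, clarsimp)
      fix v u v' u'
      assume "v \<in> quotient_reps J I" "u \<in> quotient_reps I K" "v' \<in> quotient_reps J I"
        "u' \<in> quotient_reps I K" "v \<otimes> u = v' \<otimes> u'"
      then show "v = v' \<and> u = u'"
        using coset_unique[OF IS, of v v' u u'] by (auto simp: quotient_reps_def)
    qed
    fix w assume "w \<in> (\<lambda>(v, u). v \<otimes> u) ` (quotient_reps J I \<times> quotient_reps I K)"
    then show "w \<in> quotient_reps J K"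
      using iff parabolic_mult[OF assms(3)] parabolic_mono[OF assms(2)]
      by (auto simp: quotient_reps_def)
  next
    fix w assume w: "w \<in> quotient_reps J K"
    then obtain v u where "v \<in> quotient_reps J I" "u \<in> parabolic W s I" "w = v \<otimes> u"
      using coset_decomposition[OF assms(2,3), of w] by (auto simp: quotient_reps_def)
    moreover from this have "u \<in> quotient_reps I K"
      using iff w by (auto simp: quotient_reps_def)
    ultimately show "w \<in> (\<lambda>(v, u). v \<otimes> u) ` (quotient_reps J I \<times> quotient_reps I K)"
      by force
  qed
qed

definition quotient_poly :: "nat set \<Rightarrow> nat set \<Rightarrow> int poly" where
  "quotient_poly J K = (\<Sum>w\<in>quotient_reps J K. monom 1 (len w))"

lemma coeff_quotient_poly:
  "coeff (quotient_poly J K) k = int (card {w \<in> quotient_reps J K. len w = k})"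
  by (simp add: quotient_poly_def coeff_sum sum.If_cases Int_def)

lemma quotient_poly_nonzero: "quotient_poly J K \<noteq> 0"
proof
  assume "quotient_poly J K = 0"
  then have "card {w \<in> quotient_reps J K. len w = 0} = 0"
    using coeff_quotient_poly[of J K 0] by simp
  then have "{w \<in> quotient_reps J K. len w = 0} = {}" by simp
  moreover have "\<one> \<in> {w \<in> quotient_reps J K. len w = 0}" by simp
  ultimately show False by blast
qed

lemma quotient_poly_mult:
  assumes "K \<subseteq> I" "I \<subseteq> J" "J \<subseteq> S"
  shows "quotient_poly J K = quotient_poly J I * quotient_poly I K"
proof -
  have "quotient_poly J K =
      (\<Sum>(v, u)\<in>quotient_reps J I \<times> quotient_reps I K. monom 1 (len (v \<otimes> u)))"
    unfolding quotient_poly_def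
    by (subst sum.reindex_bij_betw[OF quotient_reps_bij[OF assms], symmetric])
      (simp add: case_prod_beta)
  also have "\<dots> = (\<Sum>(v, u)\<in>quotient_reps J I \<times> quotient_reps I K.
      monom 1 (len v) * monom 1 (len u))"
    using assms by (intro sum.cong)
      (auto simp: quotient_reps_def mult_monom len_mult_minimal_rep[OF subset_trans[OF assms(2,3)]])
  also have "\<dots> = quotient_poly J I * quotient_poly I K"
    by (simp add: quotient_poly_def sum_product sum.cartesian_product)
  finally show ?thesis .
qed

lemma quotient_poly_same: "I \<subseteq> S \<Longrightarrow> quotient_poly I I = 1"
proof -
  assume I: "I \<subseteq> S"
  have "w = \<one>" if "w \<in> quotient_reps I I" for w
  proof (rule ccontr)
    assume "w \<noteq> \<one>"
    moreover have "w \<in> parabolic W s I" using that by (simp add: quotient_reps_def)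
    ultimately obtain i where "i \<in> I" "len (w \<otimes> s i) < len w"
      using parabolic_descent[OF I] by metis
    then show False
      using that I nonneg_root_iff[of w i] by (auto simp: quotient_reps_def minimal_reps_def)
  qed
  then have "quotient_reps I I = {\<one>}"
    using one_in_quotient_reps by blast
  then show ?thesis by (simp add: quotient_poly_def)
qed

lemma degree_quotient_poly:
  "degree (quotient_poly J K) = Max (len ` quotient_reps J K)"
proof (rule antisym)
  have fin: "finite (len ` quotient_reps J K)" "len ` quotient_reps J K \<noteq> {}"
    by (simp, use one_in_quotient_reps[of J K] in blast)
  show "degree (quotient_poly J K) \<le> Max (len ` quotient_reps J K)"
    unfolding quotient_poly_def using fin
    by (intro degree_sum_le) (auto intro: order_trans[OF degree_monom_le])
  have "Max (len ` quotient_reps J K) \<in> len ` quotient_reps J K"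
    using fin by (rule Max_in)
  then have "{w \<in> quotient_reps J K. len w = Max (len ` quotient_reps J K)} \<noteq> {}"
    by auto
  then have "coeff (quotient_poly J K) (Max (len ` quotient_reps J K)) \<noteq> 0"
    unfolding coeff_quotient_poly by simp
  then show "Max (len ` quotient_reps J K) \<le> degree (quotient_poly J K)"
    by (rule le_degree)
qed

lemma len_longest_element:
  assumes "I \<subseteq> S"
  shows "len (longest_element W n s I) = degree (quotient_poly I {})"
proof -
  have reps: "quotient_reps I {} = parabolic W s I"
    using assms by (auto simp: quotient_reps_def minimal_reps_def)
  have fin: "finite (parabolic W s I)" using finite_quotient_reps[of I "{}"] by (simp add: reps)
  have le: "\<forall>w. w \<in> parabolic W s I \<longrightarrow> len w < Suc (Max (len ` parabolic W s I))"
    using fin by (auto simp: less_Suc_eq_le)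
  have "longest_element W n s I \<in> parabolic W s I"
    "\<forall>w. w \<in> parabolic W s I \<longrightarrow> len w \<le> len (longest_element W n s I)"
    using arg_max_nat_lemma[of "\<lambda>w. w \<in> parabolic W s I" \<one> len, OF _ le]
    unfolding longest_element_def by auto
  then show ?thesis
    unfolding degree_quotient_poly reps using fin
    by (intro Max_eqI[symmetric]) auto
qed

end

section \<open>The numbers game\<close>

fun prefix_nonneg :: "'b list \<Rightarrow> 'a::{zero,ord} list \<Rightarrow> bool" where
  "prefix_nonneg [] ys = True"
| "prefix_nonneg (p # ps) [] = True"
| "prefix_nonneg (p # ps) (y # ys) = (0 \<le> y \<and> prefix_nonneg ps ys)"

fun fire :: "'a \<Rightarrow> 'a list \<Rightarrow> 'a::{minus,times} list \<Rightarrow> 'a list" where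
  "fire a (r # rs) (x # xs) = (x - r * a) # fire a rs xs"
| "fire a _ _ = []"

text \<open>A state lists the coordinates and \<open>pre\<close> serves only as a counter of the positions
  already passed. A child survives only if the fired position is its first negative one, so
  that distinct parents never produce the same child and no duplicates have to be removed.\<close>

fun children ::
    "'a list \<Rightarrow> 'a list list \<Rightarrow> 'a list \<Rightarrow> 'a::{zero,ord,minus,times} list \<Rightarrow> 'a list list" where
  "children pre (r # rs) (a # as) x =
    (if 0 < a then
       let y = fire a r x in
       if prefix_nonneg pre y then y # children (a # pre) rs as x else children (a # pre) rs as x
     else children (a # pre) rs as x)"
| "children pre _ _ x = []"

text \<open>Counting in \<open>int\<close> keeps layer sizes as binary numerals during evaluation,
  instead of unary successors.\<close>

fun int_length :: "'b list \<Rightarrow> int" where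
  "int_length [] = 0"
| "int_length (x # xs) = 1 + int_length xs"

text \<open>For arbitrary rows the game may go on forever. A tail-recursive partial function has its
  equation unconditionally, and for a finite group it is later shown to stop.\<close>

partial_function (tailrec) levels ::
    "'a list list \<Rightarrow> int list \<Rightarrow> 'a::{zero,ord,minus,times} list list \<Rightarrow> int list" where
  [code]: "levels rows acc L =
    (case L of [] \<Rightarrow> rev acc
     | _ \<Rightarrow> levels rows (int_length L # acc) (concat (map (\<lambda>x. children [] rows x x) L)))"

text \<open>The start is the state of the identity: the \<open>i\<close>-th coordinates of the
  simple roots.\<close>

definition game ::
    "(nat \<Rightarrow> nat \<Rightarrow> 'a::{zero,one,ord,minus,times}) \<Rightarrow> nat \<Rightarrow> nat list \<Rightarrow> int list" where
  "game c i K = levels (map (\<lambda>k. map (c k) (i # K)) (i # K)) [] [1 # map (\<lambda>_. 0) K]"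

lemma int_length_eq: "int_length xs = int (length xs)"
  by (induction xs) auto

lemma fire_map: "fire a (map f ks) (map x ks) = map (\<lambda>l. x l - f l * a) ks"
  by (induction ks) auto

lemma prefix_nonneg_map:
  "length pre = length ps \<Longrightarrow> prefix_nonneg pre (map f (ps @ ks)) \<longleftrightarrow> (\<forall>l\<in>set ps. 0 \<le> f l)"
  by (induction pre ps rule: list_induct2) auto

lemma children_map:
  assumes "distinct (ps @ ks)" "length pre = length ps"
  shows "children pre (map (\<lambda>k. map (c k) (ps @ ks)) ks) (map x ks) (map x (ps @ ks)) =
    map (\<lambda>k. map (\<lambda>l. x l - c k l * x k) (ps @ ks))
      (filter (\<lambda>k. 0 < x k \<and>
        (\<forall>l\<in>set (takeWhile (\<lambda>l. l \<noteq> k) (ps @ ks)). 0 \<le> x l - c k l * x k)) ks)"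
  using assms
proof (induction ks arbitrary: ps pre)
  case (Cons k ks)
  have IH: "children (x k # pre) (map (\<lambda>k'. map (c k') (ps @ k # ks)) ks) (map x ks)
      (map x (ps @ k # ks)) =
    map (\<lambda>k'. map (\<lambda>l. x l - c k' l * x k') (ps @ k # ks))
      (filter (\<lambda>k'. 0 < x k' \<and> (\<forall>l\<in>set (takeWhile (\<lambda>l. l \<noteq> k') (ps @ k # ks)).
        0 \<le> x l - c k' l * x k')) ks)"
    using Cons.IH[of "ps @ [k]" "x k # pre"] Cons.prems by simp
  have before: "takeWhile (\<lambda>l. l \<noteq> k) (ps @ k # ks) = ps"
    using Cons.prems by (subst takeWhile_append2) auto
  have "prefix_nonneg pre (map (\<lambda>l. x l - c k l * x k) (ps @ k # ks)) \<longleftrightarrow>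
      (\<forall>l\<in>set ps. 0 \<le> x l - c k l * x k)"
    using Cons.prems(2) by (rule prefix_nonneg_map)
  then show ?case
    by (simp add: Let_def fire_map before IH del: map_append)
qed simp

lemma distinct_concat_map:
  assumes "distinct xs" "\<And>x. x \<in> set xs \<Longrightarrow> distinct (f x)"
    "\<And>x y z. x \<in> set xs \<Longrightarrow> y \<in> set xs \<Longrightarrow> z \<in> set (f x) \<Longrightarrow> z \<in> set (f y) \<Longrightarrow> x = y"
  shows "distinct (concat (map f xs))"
  using assms
proof (induction xs)
  case (Cons a xs)
  have "set (f a) \<inter> \<Union> (set ` f ` set xs) = {}"
    using Cons.prems(1) Cons.prems(3)[of a] by fastforce
  with Cons show ?case by simp
qed simp

section \<open>Coordinates of minimal representatives under left multiplication\<close>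

context geometric_coxeter_system
begin

definition coord :: "nat \<Rightarrow> 'a \<Rightarrow> nat \<Rightarrow> 'r" where
  "coord i w k = root (inv w) k i"

lemma coord_mult:
  "w \<in> carrier W \<Longrightarrow> k \<in> S \<Longrightarrow> l \<in> S \<Longrightarrow> coord i (s k \<otimes> w) l = coord i w l - c k l * coord i w k"
  by (simp add: coord_def inv_mult_group root_mult_generator)

lemma len_left_less:
  assumes "w \<in> carrier W" "k \<in> S"
  shows "len (s k \<otimes> w) < len w \<longleftrightarrow> nonpos (root (inv w) k)"
    and "len (s k \<otimes> w) = len w + 1 \<or> len w = len (s k \<otimes> w) + 1"
proof -
  have "inv w \<otimes> s k = inv (s k \<otimes> w)"
    using assms by (simp add: inv_mult_group)
  then have "len (inv w \<otimes> s k) = len (s k \<otimes> w)"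
    using assms by simp
  then show "len (s k \<otimes> w) < len w \<longleftrightarrow> nonpos (root (inv w) k)"
    and "len (s k \<otimes> w) = len w + 1 \<or> len w = len (s k \<otimes> w) + 1"
    using nonpos_root_iff[of "inv w" k] len_mult_generator[of "inv w" k] assms by simp_all
qed

context
  fixes i :: nat and K :: "nat set" and I :: "nat set"
  assumes I: "I = insert i K" and IS: "I \<subseteq> S" and iK: "i \<notin> K"
begin

text \<open>Negative roots \<open>y\<^sup>-\<^sup>1 \<alpha>\<^sub>k\<close> are seen by the single coordinate \<open>i\<close>: were it zero, the
  root would lie in the span of \<open>K\<close>, and applying \<open>y\<close>, which keeps that cone positive,
  would make \<open>- \<alpha>\<^sub>k\<close> positive.\<close>

lemma coord_neg:
  assumes y: "y \<in> quotient_reps I K" and k: "k \<in> I" and neg: "nonpos (root (inv y) k)"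
  shows "coord i y k < 0"
proof -
  have closed: "y \<in> carrier W" "k \<in> S" "i \<in> S" "K \<subseteq> S" and yK: "y \<in> minimal_reps K"
    using y k IS I by (auto simp: quotient_reps_def minimal_reps_def)
  have inv_y: "inv y \<in> parabolic W s I"
    using y IS parabolic_inv by (auto simp: quotient_reps_def)
  have "coord i y k \<noteq> 0"
  proof
    assume zero: "coord i y k = 0"
    have "nonneg (action y (\<lambda>l. - root (inv y) k l))"
    proof (rule minimal_reps_cone[OF yK \<open>K \<subseteq> S\<close>])
      show "nonneg (\<lambda>l. - root (inv y) k l)"
        using neg by (simp add: nonpos_uminus)
      show "- root (inv y) k l = 0" if "l \<notin> K" for l
        using that zero root_outside[OF IS inv_y k] by (cases "l = i") (auto simp: coord_def I)
    qed
    moreover have "action y (\<lambda>l. - root (inv y) k l) = (\<lambda>l. - simple k l)"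
      using action_scale[of y "- 1" "root (inv y) k"] closed by (simp add: root_def)
    ultimately have "0 \<le> - (simple k k :: 'r)"
      unfolding nonneg_def by metis
    then have "(1::'r) \<le> 0" by (simp add: simple_def)
    then show False
      using zero_less_one[where 'a='r] by (metis less_le_not_le)
  qed
  then show ?thesis
    using neg by (simp add: coord_def nonpos_def less_le)
qed

text \<open>The order of the coefficients is partial, so comparability with zero has to come from
  the sign of the whole root.\<close>

lemma coord_cases:
  assumes y: "y \<in> quotient_reps I K" and k: "k \<in> I"
  shows "0 \<le> coord i y k \<or> coord i y k < 0"
    and "coord i y k < 0 \<longleftrightarrow> len (s k \<otimes> y) < len y"
proof -
  have closed: "y \<in> carrier W" "k \<in> S"
    using y k IS by (auto simp: quotient_reps_def minimal_reps_def)
  have cases: "nonneg (root (inv y) k) \<or> nonpos (root (inv y) k)"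
    using root_cases closed by simp
  then show "0 \<le> coord i y k \<or> coord i y k < 0"
    using coord_neg[OF y k] by (auto simp: nonneg_def coord_def)
  have "\<not> nonneg (root (inv y) k)" if "coord i y k < 0"
    using that by (auto simp: nonneg_def coord_def less_le_not_le)
  then show "coord i y k < 0 \<longleftrightarrow> len (s k \<otimes> y) < len y"
    using coord_neg[OF y k] cases len_left_less(1)[OF closed] by blast
qed

text \<open>For \<open>j\<close> in \<open>K\<close>, \<open>y \<otimes> s j\<close> is longer than
  \<open>y\<close>, and left multiplication changes its length by one. So
  \<open>s k \<otimes> y \<otimes> s j\<close> is at least as long as \<open>y\<close>, hence longer
  than \<open>s k \<otimes> y\<close>.\<close>

lemma descend:
  assumes y: "y \<in> quotient_reps I K" and k: "k \<in> I" and neg: "coord i y k < 0"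
  shows "s k \<otimes> y \<in> quotient_reps I K" "len y = len (s k \<otimes> y) + 1"
proof -
  have closed: "y \<in> carrier W" "k \<in> S"
    using y k IS by (auto simp: quotient_reps_def minimal_reps_def)
  have less: "len (s k \<otimes> y) < len y"
    using neg coord_cases(2)[OF y k] by simp
  then show len: "len y = len (s k \<otimes> y) + 1"
    using len_left_less(2)[OF closed] by auto
  have "nonneg (root (s k \<otimes> y) j)" if j: "j \<in> K" for j
  proof -
    have jS: "j \<in> S" using j IS I by auto
    have "s k \<otimes> (s k \<otimes> y \<otimes> s j) = y \<otimes> s j"
      using closed jS by (simp flip: m_assoc)
    then have "len (y \<otimes> s j) \<le> len (s k \<otimes> y \<otimes> s j) + 1"
      using len_left_less(2)[of "s k \<otimes> y \<otimes> s j" k] closed jS by auto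
    moreover have "len (y \<otimes> s j) = len y + 1"
      using y j closed jS nonneg_root_iff[of y j] len_mult_generator[of y j]
      by (auto simp: quotient_reps_def minimal_reps_def)
    ultimately show ?thesis
      using len nonneg_root_iff[of "s k \<otimes> y" j] closed jS by simp
  qed
  then show "s k \<otimes> y \<in> quotient_reps I K"
    using y k closed IS
    by (auto simp: quotient_reps_def minimal_reps_def intro: parabolic_mult parabolic_generator)
qed

text \<open>Reflection in \<open>k\<close> alters only coordinate \<open>k\<close>, so a positive
  \<open>root w j\<close> that turns negative is a positive multiple of \<open>simple k\<close>.
  Applying \<open>inv w\<close>, \<open>simple j\<close> becomes a positive multiple of
  \<open>root (inv w) k\<close>; but its coordinate \<open>i\<close> is 0 for \<open>j\<close> in
  \<open>K\<close>, while that of the root is positive.\<close>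

lemma ascend:
  assumes w: "w \<in> quotient_reps I K" and k: "k \<in> I" and pos: "0 < coord i w k"
  shows "s k \<otimes> w \<in> quotient_reps I K" "len (s k \<otimes> w) = len w + 1"
proof -
  have closed: "w \<in> carrier W" "k \<in> S"
    using w k IS by (auto simp: quotient_reps_def minimal_reps_def)
  have "\<not> len (s k \<otimes> w) < len w"
    using pos coord_cases(2)[OF w k] by auto
  then show "len (s k \<otimes> w) = len w + 1"
    using len_left_less(2)[OF closed] by auto
  have "nonneg (root (s k \<otimes> w) j)" if j: "j \<in> K" for j
  proof (rule ccontr)
    assume not: "\<not> nonneg (root (s k \<otimes> w) j)"
    have jS: "j \<in> S" using j IS I by auto
    have root_j: "nonneg (root w j)"
      using w j by (simp add: quotient_reps_def minimal_reps_def)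
    have nonpos: "nonpos (reflect k (root w j))"
      using not root_cases[of "s k \<otimes> w" j] closed jS by (simp add: root_mult)
    have zero: "root w j l = 0" if "l \<noteq> k" for l
    proof (rule order_antisym)
      have "reflect k (root w j) l \<le> 0"
        using nonpos unfolding nonpos_def by blast
      then show "root w j l \<le> 0" using that by (simp add: reflect_def)
      show "0 \<le> root w j l" using root_j by (simp add: nonneg_def)
    qed
    then have root_eq: "root w j = (\<lambda>l. root w j k * simple k l)"
      by (auto simp: simple_def)
    have "root w j k \<noteq> 0"
      using zero root_nonzero[of w j] closed by (auto simp: fun_eq_iff) (metis)
    then have "0 < root w j k"
      using root_j by (auto simp: nonneg_def less_le)
    have "simple j = action (inv w) (root w j)"
      using closed by (simp add: root_def)
    also have "\<dots> = (\<lambda>l. root w j k * root (inv w) k l)"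
      by (subst root_eq) (simp add: action_scale root_def)
    finally have "simple j i = root w j k * coord i w k"
      by (simp add: coord_def)
    moreover have "simple j i = (0::'r)"
      using j iK by (auto simp: simple_def)
    ultimately show False
      using cone_mult_pos[OF \<open>0 < root w j k\<close> pos] by simp
  qed
  then show "s k \<otimes> w \<in> quotient_reps I K"
    using w k closed IS
    by (auto simp: quotient_reps_def minimal_reps_def intro: parabolic_mult parabolic_generator)
qed

section \<open>Layers of equal length and their unique parents\<close>

definition layer :: "nat \<Rightarrow> 'a set" where
  "layer d = {w \<in> quotient_reps I K. len w = d}"

context
  fixes Is :: "nat list"
  assumes Is: "set Is = I" "distinct Is"
begin

definition state :: "'a \<Rightarrow> 'r list" where
  "state w = map (coord i w) Is"

definition first_descent :: "'a \<Rightarrow> nat \<Rightarrow> bool" where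
  "first_descent y k \<longleftrightarrow> k \<in> I \<and> coord i y k < 0 \<and>
     (\<forall>l\<in>set (takeWhile (\<lambda>l. l \<noteq> k) Is). 0 \<le> coord i y l)"

definition successors :: "'a \<Rightarrow> 'a list" where
  "successors w = map (\<lambda>k. s k \<otimes> w) (filter (\<lambda>k. 0 < coord i w k \<and>
      (\<forall>l\<in>set (takeWhile (\<lambda>l. l \<noteq> k) Is). 0 \<le> coord i (s k \<otimes> w) l)) Is)"

lemma first_descent_unique:
  assumes "first_descent y k" "first_descent y k'"
  shows "k = k'"
proof (rule ccontr)
  assume "k \<noteq> k'"
  obtain xs ys where "Is = xs @ k # ys" "k \<notin> set xs"
    using assms Is split_list_first unfolding first_descent_def by metis
  moreover obtain xs' ys' where "Is = xs' @ k' # ys'" "k' \<notin> set xs'"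
    using assms Is split_list_first unfolding first_descent_def by metis
  \<comment> \<open>Of two distinct members of the list one precedes the other; it would be both
    negative and nonnegative.\<close>
  ultimately have "k \<in> set (takeWhile (\<lambda>l. l \<noteq> k') Is) \<or> k' \<in> set (takeWhile (\<lambda>l. l \<noteq> k) Is)"
    using \<open>k \<noteq> k'\<close> by (auto simp: append_eq_append_conv2 takeWhile_append append_eq_Cons_conv Cons_eq_append_conv)
  then show False
    using assms by (auto simp: first_descent_def less_le_not_le)
qed

lemma first_descent_exists:
  assumes "y \<in> quotient_reps I K" "y \<noteq> \<one>"
  shows "\<exists>k. first_descent y k"
proof -
  have "inv y \<in> parabolic W s I" "inv y \<noteq> \<one>" and closed: "y \<in> carrier W"
    using assms IS parabolic_inv by (auto simp: quotient_reps_def)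
  then obtain k where k: "k \<in> I" "len (inv y \<otimes> s k) < len (inv y)"
    using parabolic_descent[OF IS] by metis
  then have "nonpos (root (inv y) k)"
    using nonpos_root_iff[of "inv y" k] closed IS by auto
  then have "coord i y k < 0"
    using coord_neg assms(1) k by blast
  then obtain xs k' ys where split: "Is = xs @ k' # ys" "coord i y k' < 0"
    "\<forall>l\<in>set xs. \<not> coord i y l < 0"
    using split_list_first_prop[of Is "\<lambda>k. coord i y k < 0"] k Is by blast
  have "k' \<notin> set xs"
    using Is(2) by (simp add: split(1))
  then have "takeWhile (\<lambda>l. l \<noteq> k') Is = xs"
    unfolding split(1) by (subst takeWhile_append2) auto
  moreover have "0 \<le> coord i y l" if "l \<in> set xs" for l
    using that split coord_cases(1)[OF assms(1), of l] Is by auto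
  moreover have "k' \<in> I"
    using Is(1) by (auto simp: split(1))
  ultimately have "first_descent y k'"
    using split(2) by (simp add: first_descent_def)
  then show ?thesis ..
qed

lemma coord_same: "w \<in> carrier W \<Longrightarrow> k \<in> S \<Longrightarrow> coord i (s k \<otimes> w) k = - coord i w k"
  by (simp add: coord_mult diag_S)

lemma successors_iff:
  assumes "w \<in> quotient_reps I K"
  shows "y \<in> set (successors w) \<longleftrightarrow> (\<exists>k. first_descent y k \<and> y = s k \<otimes> w)"
proof -
  have closed: "w \<in> carrier W" using assms by (auto simp: quotient_reps_def minimal_reps_def)
  have "0 < coord i w k \<longleftrightarrow> coord i (s k \<otimes> w) k < 0" if "k \<in> I" for k
    using closed that IS by (subst coord_same) auto
  then show ?thesis
    using Is by (auto simp: successors_def first_descent_def)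
qed

lemma concat_successors:
  assumes "distinct ws" "set ws = layer d"
  shows "distinct (concat (map successors ws))" "set (concat (map successors ws)) = layer (Suc d)"
proof -
  have ws: "w \<in> quotient_reps I K" "w \<in> carrier W" "len w = d" if "w \<in> set ws" for w
    using that assms by (auto simp: layer_def quotient_reps_def minimal_reps_def)
  show "distinct (concat (map successors ws))"
  proof (rule distinct_concat_map[OF assms(1)])
    fix w assume w: "w \<in> set ws"
    have "inj_on (\<lambda>k. s k \<otimes> w) {k. first_descent (s k \<otimes> w) k}"
      by (rule inj_onI) (metis (mono_tags) first_descent_unique mem_Collect_eq)
    moreover have "set (filter (\<lambda>k. 0 < coord i w k \<and> (\<forall>l\<in>set (takeWhile (\<lambda>l. l \<noteq> k) Is).
        0 \<le> coord i (s k \<otimes> w) l)) Is) \<subseteq> {k. first_descent (s k \<otimes> w) k}"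
    proof clarsimp
      fix k assume k: "k \<in> set Is" "0 < coord i w k"
        "\<forall>l\<in>set (takeWhile (\<lambda>l. l \<noteq> k) Is). 0 \<le> coord i (s k \<otimes> w) l"
      then have "coord i (s k \<otimes> w) k < 0"
        using ws[OF w] Is IS by (subst coord_same) auto
      with k show "first_descent (s k \<otimes> w) k"
        using Is by (simp add: first_descent_def)
    qed
    ultimately show "distinct (successors w)"
      unfolding successors_def using Is(2) by (subst distinct_map) (meson distinct_filter inj_on_subset)
  next
    fix w w' y
    assume w: "w \<in> set ws" "w' \<in> set ws" and y: "y \<in> set (successors w)" "y \<in> set (successors w')"
    obtain k where k: "first_descent y k" "y = s k \<otimes> w"
      using successors_iff ws w y by blast
    obtain k' where k': "first_descent y k'" "y = s k' \<otimes> w'"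
      using successors_iff ws w y by blast
    have "k \<in> S" using k IS by (auto simp: first_descent_def)
    moreover have "k' = k" using first_descent_unique k k' by blast
    then have "s k \<otimes> w = s k \<otimes> w'" using k k' by simp
    ultimately show "w = w'"
      using ws w by simp
  qed
  show "set (concat (map successors ws)) = layer (Suc d)"
  proof (intro equalityI subsetI)
    fix y assume "y \<in> set (concat (map successors ws))"
    then obtain w where w: "w \<in> set ws" "y \<in> set (successors w)" by auto
    then obtain k where k: "k \<in> I" "0 < coord i w k" "y = s k \<otimes> w"
      using Is by (auto simp: successors_def)
    then show "y \<in> layer (Suc d)"
      using ascend[OF ws(1)[OF w(1)] k(1,2)] ws[OF w(1)] by (simp add: layer_def)
  next
    fix y assume "y \<in> layer (Suc d)"
    then have y: "y \<in> quotient_reps I K" "len y = Suc d" "y \<noteq> \<one>"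
      by (auto simp: layer_def)
    then obtain k where k: "first_descent y k"
      using first_descent_exists by blast
    then have kI: "k \<in> I" "coord i y k < 0" "k \<in> S"
      using IS by (auto simp: first_descent_def)
    have "s k \<otimes> y \<in> set ws"
      using descend[OF y(1) kI(1,2)] y assms(2) by (simp add: layer_def)
    moreover have "y = s k \<otimes> (s k \<otimes> y)"
      using kI y(1) by (auto simp: quotient_reps_def minimal_reps_def simp flip: m_assoc)
    then have "y \<in> set (successors (s k \<otimes> y))"
      using successors_iff ws calculation k by blast
    ultimately show "y \<in> set (concat (map successors ws))" by auto
  qed
qed

abbreviation "rows \<equiv> map (\<lambda>k. map (c k) Is) Is"

lemma children_state:
  assumes "w \<in> quotient_reps I K"
  shows "children [] rows (state w) (state w) = map state (successors w)"
proof -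
  have closed: "w \<in> carrier W" using assms by (auto simp: quotient_reps_def minimal_reps_def)
  have coord: "coord i (s k \<otimes> w) l = coord i w l - c k l * coord i w k"
    if "k \<in> set Is" "l \<in> set Is" for k l
    using that closed Is IS by (intro coord_mult) auto
  have filter: "filter (\<lambda>k. 0 < coord i w k \<and> (\<forall>l\<in>set (takeWhile (\<lambda>l. l \<noteq> k) Is).
        0 \<le> coord i w l - c k l * coord i w k)) Is =
      filter (\<lambda>k. 0 < coord i w k \<and> (\<forall>l\<in>set (takeWhile (\<lambda>l. l \<noteq> k) Is).
        0 \<le> coord i (s k \<otimes> w) l)) Is" (is "filter ?P Is = filter ?P' Is")
  proof (rule filter_cong[OF HOL.refl])
    fix k assume k: "k \<in> set Is"
    have "coord i (s k \<otimes> w) l = coord i w l - c k l * coord i w k"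
      if "l \<in> set (takeWhile (\<lambda>l. l \<noteq> k) Is)" for l
      using coord[OF k] set_takeWhileD[OF that] by blast
    then show "?P k = ?P' k" by simp
  qed
  have "children [] rows (state w) (state w) =
      map (\<lambda>k. map (\<lambda>l. coord i w l - c k l * coord i w k) Is) (filter ?P Is)"
    using children_map[of "[]" Is "[]" c "coord i w"] Is(2) by (simp add: state_def)
  also have "\<dots> = map (\<lambda>k. state (s k \<otimes> w)) (filter ?P' Is)"
    by (rule map_cong[OF filter]) (simp add: state_def coord)
  finally show ?thesis
    by (simp add: successors_def comp_def)
qed

text \<open>Nonempty layers lie within the degree of the quotient polynomial, which bounds the
  recursion. The last entry is recorded as nonzero so that the length of the list later reveals the
  degree.\<close>

lemma levels_correct:
  assumes "distinct ws" "set ws = layer d"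
  shows "\<exists>g. levels rows acc (map state ws) = rev acc @ g \<and>
    (\<forall>k. nth_default 0 g k = int (card (layer (d + k)))) \<and> (g = [] \<or> last g \<noteq> 0)"
  using assms
proof (induction "Suc (degree (quotient_poly I K)) - d" arbitrary: ws d acc rule: less_induct)
  case less
  show ?case
  proof (cases ws)
    case Nil
    \<comment> \<open>One empty layer empties all later ones, since each layer consists of
      successors of the one before.\<close>
    have "layer (d + k) = {}" for k
    proof (induction k)
      case (Suc k)
      then show ?case
        using concat_successors(2)[of "[]" "d + k"] by simp
    qed (use Nil less.prems in simp)
    then show ?thesis
      using Nil by (subst levels.simps) simp
  next
    case (Cons w ws')
    have "card (layer d) \<noteq> 0"
      using Cons less.prems(2)[symmetric] by simp
    then have "coeff (quotient_poly I K) d \<noteq> 0"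
      by (simp add: coeff_quotient_poly layer_def)
    then have "d \<le> degree (quotient_poly I K)"
      by (rule le_degree)
    then have decreases:
      "Suc (degree (quotient_poly I K)) - Suc d < Suc (degree (quotient_poly I K)) - d"
      by simp
    have step: "concat (map (\<lambda>x. children [] rows x x) (map state ws)) =
        map state (concat (map successors ws))"
    proof -
      have "w \<in> quotient_reps I K" if "w \<in> set ws" for w
        using that less.prems by (simp add: layer_def)
      then have "map (\<lambda>w. children [] rows (state w) (state w)) ws =
          map (\<lambda>w. map state (successors w)) ws"
        by (intro map_cong children_state) auto
      from arg_cong[OF this, of concat] show ?thesis
        by (simp add: map_concat comp_def)
    qed
    obtain g where g:
      "levels rows (int (card (layer d)) # acc) (map state (concat (map successors ws))) =
        rev (int (card (layer d)) # acc) @ g"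
      "\<forall>k. nth_default 0 g k = int (card (layer (Suc d + k)))" "g = [] \<or> last g \<noteq> 0"
      using less.hyps[OF decreases concat_successors[OF less.prems]] by blast
    have "int_length (map state ws) = int (card (layer d))"
      using less.prems by (simp add: int_length_eq flip: distinct_card)
    then have "levels rows acc (map state ws) =
        levels rows (int (card (layer d)) # acc) (map state (concat (map successors ws)))"
      using step Cons by (subst levels.simps) simp
    then have "levels rows acc (map state ws) = rev acc @ (int (card (layer d)) # g)"
      using g(1) by simp
    moreover have "nth_default 0 (int (card (layer d)) # g) k = int (card (layer (d + k)))" for k
      using g(2) by (cases k) auto
    moreover have "last (int (card (layer d)) # g) \<noteq> 0"
      using g(3) \<open>card (layer d) \<noteq> 0\<close> by auto
    ultimately show ?thesis by blast
  qed
qed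

end

end

text \<open>The leading 1 counts the identity and makes the list a legitimate divisor; the exact
  degree is what division and the lengths of longest elements rely on.\<close>

lemma game_correct:
  assumes "set (i # K) \<subseteq> S" "distinct (i # K)"
  shows "\<exists>q. game c i K = 1 # q \<and> Poly (1 # q) = quotient_poly (set (i # K)) (set K) \<and>
    degree (quotient_poly (set (i # K)) (set K)) = length q"
proof -
  let ?I = "insert i (set K)" and ?K = "set K"
  have hyps: "?I = insert i ?K" "?I \<subseteq> S" "i \<notin> ?K" "set (i # K) = ?I"
    using assms by auto
  define ws where "ws = [\<one>]"
  have "\<one> \<in> quotient_reps ?I ?K" by simp
  then have "set ws = layer ?K ?I 0" "distinct ws"
    using len_eq_0 by (auto simp: ws_def layer_def[OF hyps(1-3)] quotient_reps_def minimal_reps_def)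
  from levels_correct[OF hyps(1-3) hyps(4) assms(2) this(2,1), of "[]"]
  obtain g where g: "levels (map (\<lambda>k. map (c k) (i # K)) (i # K)) [] (map (state i (i # K)) ws) = g"
    "\<And>k. nth_default 0 g k = int (card (layer ?K ?I k))" "g = [] \<or> last g \<noteq> 0"
    by auto
  have "map (state i (i # K)) ws = [1 # map (\<lambda>_. 0) K]"
    using assms(2) by (auto simp: ws_def state_def[OF hyps(1-3) hyps(4) assms(2)] coord_def simple_def)
  then have game: "game c i K = g"
    using g(1) by (simp add: game_def)
  have poly: "Poly g = quotient_poly ?I ?K"
    by (rule poly_eqI) (simp add: g(2) coeff_quotient_poly layer_def[OF hyps(1-3)])
  have "layer ?K ?I 0 = {\<one>}"
    using \<open>set ws = layer ?K ?I 0\<close> by (simp add: ws_def)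
  then have "nth_default 0 g 0 = 1"
    by (simp add: g(2))
  then obtain q where q: "g = 1 # q"
    by (cases g) auto
  have "degree (Poly g) = length q"
  proof (rule antisym)
    show "degree (Poly g) \<le> length q"
      by (rule degree_le) (simp add: q nth_default_def del: Poly.simps)
    have "nth_default 0 g (length q) = last g"
      by (simp add: q nth_default_nth last_conv_nth del: last.simps)
    then have "nth_default 0 g (length q) \<noteq> 0"
      using g(3) q by simp
    then show "length q \<le> degree (Poly g)"
      by (intro le_degree) simp
  qed
  then show ?thesis
    using game poly q by (simp del: Poly.simps)
qed

end

section \<open>Counting\<close>

fun dot :: "int list \<Rightarrow> int list \<Rightarrow> int" where
  "dot (a # as) (b # bs) = a * b + dot as bs"
| "dot _ _ = 0"

text \<open>Exact division by \<open>1 # q\<close>: the accumulator holds the quotient coefficients found so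
  far, latest first, and the third argument only fixes how many are wanted.\<close>

fun divs :: "int list \<Rightarrow> int list \<Rightarrow> int list \<Rightarrow> int list \<Rightarrow> int list" where
  "divs q acc (r # rs) (a # as) = divs q ((a - dot q acc) # acc) rs as"
| "divs q acc _ _ = rev acc"

definition pdiv :: "int list \<Rightarrow> int list \<Rightarrow> int list" where
  "pdiv as Q = divs (tl Q) [] (drop (length (tl Q)) as) as"

fun padd :: "int list \<Rightarrow> int list \<Rightarrow> int list" where
  "padd (x # xs) (y # ys) = (x + y) # padd xs ys"
| "padd [] ys = ys"
| "padd xs [] = xs"

fun pmul :: "int list \<Rightarrow> int list \<Rightarrow> int list" where
  "pmul [] ys = []"
| "pmul (x # xs) ys = padd (map ((*) x) ys) (0 # pmul xs ys)"

fun merge_tables :: "(nat \<times> int list) list \<Rightarrow> (nat \<times> int list) list \<Rightarrow> (nat \<times> int list) list" where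
  "merge_tables ((d, x) # xs) ((e, y) # ys) = (max d e, padd x y) # merge_tables xs ys"
| "merge_tables [] ys = ys"
| "merge_tables xs [] = xs"

text \<open>Entry \<open>r\<close> of the result ranges over the sets \<open>K \<union> R\<close> with \<open>R\<close> an \<open>r\<close>-subset of the
  list: the largest length of a longest element, and the sum of the polynomials of minimal
  representatives.\<close>

fun quotient_table :: "(nat \<Rightarrow> nat \<Rightarrow> 'a::{zero,one,ord,minus,times}) \<Rightarrow> nat list \<Rightarrow> nat list \<Rightarrow>
    nat \<Rightarrow> int list \<Rightarrow> (nat \<times> int list) list" where
  "quotient_table c K [] d G = [(d, G)]"
| "quotient_table c K (i # is) d G =
    (let Q = game c i K in
     merge_tables (quotient_table c K is d G) ((0, []) # quotient_table c (i # K) is (d + length (tl Q)) (pdiv G Q)))"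

fun total_poly :: "(nat \<Rightarrow> nat \<Rightarrow> 'a::{zero,one,ord,minus,times}) \<Rightarrow> nat list \<Rightarrow> nat list \<Rightarrow> int list" where
  "total_poly c K [] = [1]"
| "total_poly c K (i # is) = pmul (game c i K) (total_poly c (i # K) is)"

fun binom :: "nat \<Rightarrow> nat \<Rightarrow> int" where
  "binom n 0 = 1"
| "binom 0 (Suc k) = 0"
| "binom (Suc n) (Suc k) = binom n k + binom n (Suc k)"

text \<open>The inner sum is inclusion-exclusion for the elements with exactly \<open>n - d\<close> ascents.\<close>

definition proper_count :: "nat \<Rightarrow> (nat \<times> int list) list \<Rightarrow> int" where
  "proper_count n T =
    (\<Sum>d\<leftarrow>[0..<Suc n]. \<Sum>k\<leftarrow>[n - d..<Suc n]. (- 1) ^ (k - (n - d)) * binom k (n - d) *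
       sum_list (take (Suc (n + fst (nth_default (0, []) T d))) (snd (nth_default (0, []) T k))))"

section \<open>Polynomial arithmetic on coefficient lists\<close>

lemma binom_eq: "binom n k = int (n choose k)"
  by (induction n k rule: binom.induct) auto

text \<open>The reversed list is the accumulator of \<open>divs\<close>, with the latest coefficient
  first.\<close>

lemma coeff_Poly_mult_eq_dot:
  "coeff (Poly q * B) k = dot q (rev (map (coeff B) [0..<Suc k]))"
proof (induction q arbitrary: k)
  case (Cons a q)
  have "coeff (Poly (a # q) * B) k = a * coeff B k + (case k of 0 \<Rightarrow> 0 | Suc k' \<Rightarrow> coeff (Poly q * B) k')"
    by (simp add: coeff_pCons split: nat.split)
  then show ?case
    using Cons by (auto split: nat.split)
qed simp

lemma divs_correct:
  assumes "\<And>k. nth_default 0 as k = coeff (Poly (1 # q) * B) k"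
  shows "divs q (rev (map (coeff B) [0..<k])) rs (drop k as) =
    map (coeff B) [0..<k + min (length rs) (length as - k)]"
proof (induction rs arbitrary: k)
  case (Cons r rs)
  show ?case
  proof (cases "k < length as")
    case True
    then have drop: "drop k as = as ! k # drop (Suc k) as"
      by (rule Cons_nth_drop_Suc[symmetric])
    \<comment> \<open>The constant term 1 of the divisor isolates \<open>coeff B k\<close>; the rest
      involves only coefficients already found.\<close>
    have "as ! k = coeff B k + dot q (rev (map (coeff B) [0..<k]))"
      using assms[of k] True coeff_Poly_mult_eq_dot[of q B "k - 1"]
      by (cases k) (simp_all add: nth_default_nth coeff_pCons)
    then have "divs q (rev (map (coeff B) [0..<k])) (r # rs) (drop k as) =
        divs q (rev (map (coeff B) [0..<Suc k])) rs (drop (Suc k) as)"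
      by (simp add: drop)
    also have "\<dots> = map (coeff B) [0..<Suc k + min (length rs) (length as - Suc k)]"
      by (rule Cons.IH)
    also have "Suc k + min (length rs) (length as - Suc k) =
        k + min (length (r # rs)) (length as - k)"
      using True by auto
    finally show ?thesis .
  qed simp
qed simp

text \<open>Exactly \<open>length as - length q\<close> coefficients are computed. The degree
  hypothesis says that \<open>q\<close> wastes no places, so this number exceeds
  \<open>degree B\<close>; trailing zeros of \<open>as\<close> only add zeros.\<close>

lemma Poly_pdiv:
  assumes eq: "Poly as = B * Poly (1 # q)" and deg: "degree (Poly (1 # q)) = length q"
    and nonzero: "B \<noteq> 0"
  shows "Poly (pdiv as (1 # q)) = B"
proof -
  have "nth_default 0 as k = coeff (Poly (1 # q) * B) k" for k
    using arg_cong[OF eq, of "\<lambda>p. coeff p k"] by (simp only: coeff_Poly_eq mult.commute)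
  from divs_correct[OF this, of 0 "drop (length q) as"]
  have pdiv: "pdiv as (1 # q) = map (coeff B) [0..<length as - length q]"
    by (simp add: pdiv_def)
  have Q: "Poly (1 # q) \<noteq> 0" by simp
  have degree: "degree (Poly as) = degree B + length q"
    unfolding eq by (simp only: degree_mult_eq[OF nonzero Q] deg)
  have "Poly as \<noteq> 0"
    unfolding eq using nonzero Q by (simp only: mult_eq_0_iff not_False_eq_True simp_thms)
  have "degree (Poly as) < length as"
  proof (rule ccontr)
    assume "\<not> degree (Poly as) < length as"
    then have "coeff (Poly as) (degree (Poly as)) = 0"
      by (simp add: nth_default_beyond)
    with \<open>Poly as \<noteq> 0\<close> show False by (simp only: leading_coeff_0_iff)
  qed
  then have "degree B < length as - length q"
    using degree by simp
  then have "coeff B k = nth_default 0 (map (coeff B) [0..<length as - length q]) k" for k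
    by (auto simp: nth_default_def coeff_eq_0)
  then show ?thesis
    by (intro poly_eqI) (simp add: pdiv)
qed

lemma Poly_padd: "Poly (padd xs ys) = Poly xs + Poly ys"
  by (induction xs ys rule: padd.induct) auto

lemma Poly_pmul: "Poly (pmul xs ys) = Poly xs * Poly ys"
proof (induction xs)
  case (Cons x xs)
  have "Poly (map ((*) x) ys) = smult x (Poly ys)"
    by (induction ys) auto
  with Cons show ?case by (simp add: Poly_padd)
qed simp

lemma nth_default_merge_tables:
  "nth_default (0, []) (merge_tables xs ys) r =
    (max (fst (nth_default (0, []) xs r)) (fst (nth_default (0, []) ys r)),
     padd (snd (nth_default (0, []) xs r)) (snd (nth_default (0, []) ys r)))"
proof (induction xs ys arbitrary: r rule: merge_tables.induct)
  case (1 d x xs e y ys)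
  then show ?case by (cases r) auto
next
  case (3 v va)
  have "padd x [] = x" for x by (cases x) auto
  then show ?case by simp
qed auto

lemma sum_coeff_le: "(\<Sum>l\<le>L. coeff (Poly xs) l) = sum_list (take (Suc L) xs)"
proof (induction xs arbitrary: L)
  case (Cons x xs)
  show ?case
  proof (cases L)
    case (Suc L')
    then show ?thesis
      using Cons[of L'] by (simp add: sum.atMost_Suc_shift coeff_pCons del: sum.atMost_Suc coeff_Poly_eq)
  qed (simp add: coeff_pCons)
qed simp

section \<open>Subsets of fixed size and binomial inversion\<close>

definition subs :: "nat set \<Rightarrow> nat \<Rightarrow> nat set set" where
  "subs X r = {R. R \<subseteq> X \<and> card R = r}"

lemma finite_subs [simp]: "finite X \<Longrightarrow> finite (subs X r)"
  by (simp add: subs_def)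

lemma subs_0 [simp]: "finite X \<Longrightarrow> subs X 0 = {{}}"
  by (auto simp: subs_def finite_subset)

lemma subs_insert:
  assumes "finite X" "i \<notin> X"
  shows "subs (insert i X) (Suc r) = subs X (Suc r) \<union> insert i ` subs X r"
proof (intro equalityI subsetI)
  fix R assume R: "R \<in> subs (insert i X) (Suc r)"
  show "R \<in> subs X (Suc r) \<union> insert i ` subs X r"
  proof (cases "i \<in> R")
    case True
    then have "R = insert i (R - {i})" "R - {i} \<in> subs X r"
      using R assms finite_subset[of R "insert i X"] by (auto simp: subs_def)
    then show ?thesis by blast
  qed (use R in \<open>auto simp: subs_def\<close>)
next
  fix R assume "R \<in> subs X (Suc r) \<union> insert i ` subs X r"
  then show "R \<in> subs (insert i X) (Suc r)"
    using assms finite_subset[of _ X] by (auto simp: subs_def subset_iff card_insert_if)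
qed

lemma sum_subs_insert:
  assumes "finite X" "i \<notin> X"
  shows "sum f (subs (insert i X) (Suc r)) =
    sum f (subs X (Suc r)) + (\<Sum>R\<in>subs X r. f (insert i R))"
proof -
  have "inj_on (insert i) (subs X r)"
    using assms(2) by (intro inj_onI) (auto simp: subs_def)
  moreover have "subs X (Suc r) \<inter> insert i ` subs X r = {}"
    using assms(2) by (auto simp: subs_def)
  ultimately show ?thesis
    using assms by (simp add: subs_insert sum.union_disjoint sum.reindex)
qed

text \<open>The extra 0 gives a value to the empty family, in agreement with the default entry of
  the table.\<close>

definition max_over :: "(nat set \<Rightarrow> nat) \<Rightarrow> nat set \<Rightarrow> nat \<Rightarrow> nat" where
  "max_over f X r = Max (insert 0 (f ` subs X r))"

lemma max_over_insert:
  assumes "finite X" "i \<notin> X"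
  shows "max_over f (insert i X) (Suc r) =
    max (max_over f X (Suc r)) (max_over (\<lambda>R. f (insert i R)) X r)"
proof -
  have union: "insert 0 (f ` subs (insert i X) (Suc r)) =
      insert 0 (f ` subs X (Suc r)) \<union> insert 0 ((\<lambda>R. f (insert i R)) ` subs X r)"
    using assms by (auto simp: subs_insert)
  show ?thesis
    unfolding max_over_def union by (rule Max_Un) (use assms in auto)
qed

text \<open>Choosing \<open>a\<close> out of \<open>k\<close> out of \<open>b\<close> amounts to
  choosing \<open>a\<close> out of \<open>b\<close> and then the rest, which leaves the alternating
  sum of a row of Pascal's triangle.\<close>

lemma alternating_choose_sum:
  assumes "a \<le> n" "b \<le> n"
  shows "(\<Sum>k\<in>{a..n}. (- 1) ^ (k - a) * int (k choose a) * int (b choose k)) =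
    (if a = b then 1 else 0)"
proof (cases "a \<le> b")
  case True
  have "(\<Sum>k\<in>{a..n}. (- 1) ^ (k - a) * int (k choose a) * int (b choose k)) =
      (\<Sum>k\<in>{a..b}. (- 1) ^ (k - a) * int (k choose a) * int (b choose k))"
    using assms by (intro sum.mono_neutral_right) auto
  also have "\<dots> = (\<Sum>j\<le>b - a. (- 1) ^ j * int (b choose a) * int ((b - a) choose j))"
  proof (rule sum.reindex_bij_witness[of _ "\<lambda>j. j + a" "\<lambda>k. k - a"])
    fix k assume k: "k \<in> {a..b}"
    then have "(b choose k) * (k choose a) = (b choose a) * ((b - a) choose (k - a))"
      by (intro choose_mult) auto
    then have "int (b choose k) * int (k choose a) = int (b choose a) * int ((b - a) choose (k - a))"
      by (metis of_nat_mult)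
    then show "(- 1) ^ (k - a) * int (b choose a) * int ((b - a) choose (k - a)) =
        (- 1) ^ (k - a) * int (k choose a) * int (b choose k)"
      by (simp add: mult.assoc mult.commute)
  qed (use True in auto)
  also have "\<dots> = int (b choose a) * (\<Sum>j\<le>b - a. (- 1) ^ j * int ((b - a) choose j))"
    by (simp add: sum_distrib_left mult_ac)
  also have "\<dots> = (if a = b then 1 else 0)"
    using choose_alternating_sum[of "b - a", where 'a=int] True by auto
  finally show ?thesis .
qed (auto intro: sum.neutral)

context geometric_coxeter_system
begin

abbreviation "max_len K \<equiv> degree (quotient_poly K {})"

lemma quotient_table_correct:
  assumes "distinct K" "distinct is" "set K \<inter> set is = {}" "set K \<union> set is \<subseteq> S"
    and "Poly G = quotient_poly S (set K)" "d = max_len (set K)"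
  shows "fst (nth_default (0, []) (quotient_table c K is d G) r) =
      max_over (\<lambda>R. max_len (set K \<union> R)) (set is) r \<and>
    Poly (snd (nth_default (0, []) (quotient_table c K is d G) r)) =
      (\<Sum>R\<in>subs (set is) r. quotient_poly S (set K \<union> R))"
  using assms
proof (induction "is" arbitrary: K d G r)
  case Nil
  have "subs {} (Suc r) = {}" for r by (auto simp: subs_def)
  with Nil show ?case
    by (cases r) (auto simp: max_over_def)
next
  case (Cons i "is")
  have sub: "set K \<subseteq> set (i # K)" "set (i # K) \<subseteq> S" and dist: "distinct (i # K)"
    using Cons.prems by auto
  obtain q where q: "game c i K = 1 # q" "Poly (1 # q) = quotient_poly (set (i # K)) (set K)"
    "degree (quotient_poly (set (i # K)) (set K)) = length q"
    using game_correct[OF sub(2) dist] by blast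
  have "Poly G = quotient_poly S (set (i # K)) * Poly (1 # q)"
    unfolding Cons.prems q(2) using sub by (intro quotient_poly_mult) auto
  then have G: "Poly (pdiv G (1 # q)) = quotient_poly S (set (i # K))"
    using q quotient_poly_nonzero by (intro Poly_pdiv) (simp_all del: Poly.simps)
  have "max_len (set (i # K)) = degree (quotient_poly (set (i # K)) (set K) * quotient_poly (set K) {})"
    using quotient_poly_mult[of "{}" "set K" "set (i # K)"] sub by simp
  also have "\<dots> = d + length q"
    using q(3) Cons.prems(6) quotient_poly_nonzero by (simp add: degree_mult_eq)
  finally have d: "d + length q = max_len (set (i # K))" ..
  have i: "i \<notin> set is" using Cons.prems by simp
  have IH1: "fst (nth_default (0, []) (quotient_table c K is d G) r) =
        max_over (\<lambda>R. max_len (set K \<union> R)) (set is) r \<and>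
      Poly (snd (nth_default (0, []) (quotient_table c K is d G) r)) =
        (\<Sum>R\<in>subs (set is) r. quotient_poly S (set K \<union> R))" for r
    using Cons.prems by (intro Cons.IH) auto
  have IH2: "fst (nth_default (0, []) (quotient_table c (i # K) is (d + length q) (pdiv G (1 # q))) r) =
        max_over (\<lambda>R. max_len (set (i # K) \<union> R)) (set is) r \<and>
      Poly (snd (nth_default (0, []) (quotient_table c (i # K) is (d + length q) (pdiv G (1 # q))) r)) =
        (\<Sum>R\<in>subs (set is) r. quotient_poly S (set (i # K) \<union> R))" for r
    using Cons.prems sub dist G d by (intro Cons.IH) auto
  show ?case
  proof (cases r)
    case 0
    then show ?thesis
      using IH1[of 0] by (simp add: q(1) nth_default_merge_tables Poly_padd max_over_def)
  next
    \<comment> \<open>A set of size \<open>Suc r'\<close> either omits \<open>i\<close> or is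
      \<open>i\<close> with a set of size \<open>r'\<close>; the entry put in front of the second
      table performs this shift.\<close>
    case (Suc r')
    then show ?thesis
      using IH1[of "Suc r'"] IH2[of r'] i
      by (simp add: q(1) nth_default_merge_tables Poly_padd max_over_insert sum_subs_insert)
  qed
qed

lemma total_poly_correct:
  assumes "distinct K" "distinct is" "set K \<inter> set is = {}" "set K \<union> set is \<subseteq> S"
  shows "Poly (total_poly c K is) = quotient_poly (set K \<union> set is) (set K)"
  using assms
proof (induction "is" arbitrary: K)
  case Nil
  then show ?case by (simp add: quotient_poly_same)
next
  case (Cons i "is")
  have "quotient_poly (set K \<union> set (i # is)) (set K) =
      quotient_poly (set K \<union> set (i # is)) (set (i # K)) * quotient_poly (set (i # K)) (set K)"
    using Cons.prems by (intro quotient_poly_mult) auto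
  moreover have "Poly (total_poly c (i # K) is) = quotient_poly (set K \<union> set (i # is)) (set (i # K))"
    using Cons.IH[of "i # K"] Cons.prems by simp
  moreover have "Poly (game c i K) = quotient_poly (set (i # K)) (set K)"
    using game_correct[of i K] Cons.prems by (auto simp del: Poly.simps)
  ultimately show ?case
    by (simp add: Poly_pmul mult.commute)
qed

section \<open>Ascent sets and the count of proper elements\<close>

definition ascents :: "'a \<Rightarrow> nat set" where
  "ascents w = {k \<in> S. nonneg (root w k)}"

lemma ascents_subset: "ascents w \<subseteq> S" "finite (ascents w)" "card (ascents w) \<le> n"
proof -
  show "ascents w \<subseteq> S" by (auto simp: ascents_def)
  then show "finite (ascents w)" "card (ascents w) \<le> n"
    using finite_subset card_mono[of S "ascents w"] by (auto simp: S_def)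
qed

lemma left_descent_number_eq:
  assumes "w \<in> carrier W"
  shows "left_descent_number W n s w = n - card (ascents (inv w))"
proof -
  have "{j \<in> S. len (s j \<otimes> w) < len w} = S - ascents (inv w)"
    using assms len_left_less(1)[of w] root_cases[of "inv w"] root_not_both[of "inv w"]
    by (auto simp: ascents_def)
  then have "left_descent_number W n s w = card (S - ascents (inv w))"
    by (simp add: left_descent_number_def S_def)
  then show ?thesis
    using ascents_subset by (simp add: card_Diff_subset S_def)
qed

lemma maxw0_eq:
  assumes "d \<le> n"
  shows "maxw0 W n s d = max_over max_len S d"
proof -
  \<comment> \<open>The family is nonempty, so the extra 0 in \<open>max_over\<close> does not alter
    the maximum.\<close>
  have "{1..d} \<in> subs S d" using assms by (auto simp: subs_def S_def)
  then have nonempty: "max_len ` subs S d \<noteq> {}" by auto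
  have "{len (longest_element W n s I) | I. I \<subseteq> {1..n} \<and> card I = d} =
      (\<lambda>I. len (longest_element W n s I)) ` subs S d"
    unfolding subs_def S_def[symmetric] by blast
  also have "\<dots> = max_len ` subs S d"
    by (rule image_cong) (simp_all add: subs_def len_longest_element)
  finally have "{len (longest_element W n s I) | I. I \<subseteq> {1..n} \<and> card I = d} = max_len ` subs S d" .
  then show ?thesis
    using nonempty by (simp add: maxw0_def max_over_def)
qed

text \<open>Double counting of pairs \<open>(w, R)\<close>: the minimal representatives for
  \<open>R\<close> are the \<open>w\<close> whose ascents contain \<open>R\<close>.\<close>

lemma sum_coeff_ascents:
  "(\<Sum>l\<le>L. coeff (\<Sum>R\<in>subs S k. quotient_poly S R) l) =
    (\<Sum>w | w \<in> carrier W \<and> len w \<le> L. int (card (ascents w) choose k))"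
proof -
  let ?A = "{w \<in> carrier W. len w \<le> L}"
  have finA: "finite ?A" using finite_carrier by simp
  have "(\<Sum>l\<le>L. coeff (quotient_poly S R) l) = (\<Sum>w\<in>?A. if R \<subseteq> ascents w then 1 else 0)"
    if R: "R \<in> subs S k" for R
  proof -
    have "(\<Sum>l\<le>L. coeff (quotient_poly S R) l) = (\<Sum>l\<le>L. \<Sum>w | w \<in> quotient_reps S R \<and> len w = l. 1)"
      by (simp add: coeff_quotient_poly)
    also have "\<dots> = (\<Sum>l\<le>L. \<Sum>w\<in>{w \<in> {w \<in> quotient_reps S R. len w \<le> L}. len w = l}. 1)"
      by (intro sum.cong) auto
    also have "\<dots> = (\<Sum>w | w \<in> quotient_reps S R \<and> len w \<le> L. 1)"
      by (rule sum.group) auto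
    also have "{w. w \<in> quotient_reps S R \<and> len w \<le> L} = {w \<in> ?A. R \<subseteq> ascents w}"
      using R by (auto simp: quotient_reps_def minimal_reps_def parabolic_S ascents_def subs_def)
    finally show ?thesis
      using finA by (simp add: sum.If_cases Int_def)
  qed
  note count = this
  have "(\<Sum>l\<le>L. coeff (\<Sum>R\<in>subs S k. quotient_poly S R) l) =
      (\<Sum>R\<in>subs S k. \<Sum>l\<le>L. coeff (quotient_poly S R) l)"
    unfolding coeff_sum by (rule sum.swap)
  also have "\<dots> = (\<Sum>R\<in>subs S k. \<Sum>w\<in>?A. if R \<subseteq> ascents w then 1 else 0)"
    by (rule sum.cong[OF HOL.refl]) (rule count)
  also have "\<dots> = (\<Sum>w\<in>?A. \<Sum>R\<in>subs S k. if R \<subseteq> ascents w then 1 else 0)"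
    by (rule sum.swap)
  also have "\<dots> = (\<Sum>w\<in>?A. int (card (ascents w) choose k))"
  proof (rule sum.cong[OF HOL.refl])
    fix w
    have "{R \<in> subs S k. R \<subseteq> ascents w} = {R. R \<subseteq> ascents w \<and> card R = k}"
      using ascents_subset(1)[of w] by (auto simp: subs_def)
    then show "(\<Sum>R\<in>subs S k. if R \<subseteq> ascents w then 1 else 0) = int (card (ascents w) choose k)"
      using n_subsets[OF ascents_subset(2), of w k] by (simp add: sum.If_cases Int_def)
  qed
  finally show ?thesis by simp
qed

theorem card_proper_elements:
  assumes T: "T = quotient_table c [] [1..<Suc n] 0 (total_poly c [] [1..<Suc n])"
  shows "int (card {w. proper_element W n s w}) = proper_count n T"
proof -
  have list: "distinct [1..<Suc n]" "set [1..<Suc n] = S"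
    by (auto simp: S_def)
  have "Poly (total_poly c [] [1..<Suc n]) = quotient_poly S {}"
    using total_poly_correct[of "[]" "[1..<Suc n]"] list by simp
  moreover have "max_len {} = 0"
    by (simp add: quotient_poly_same)
  ultimately have T_max: "fst (nth_default (0, []) T d) = max_over max_len S d"
    and T_poly: "Poly (snd (nth_default (0, []) T k)) = (\<Sum>R\<in>subs S k. quotient_poly S R)" for d k
    using quotient_table_correct[of "[]" "[1..<Suc n]" "total_poly c [] [1..<Suc n]" 0] list by (simp_all add: T)
  define L where "L d = n + maxw0 W n s d" for d
  define B where "B d = {w \<in> carrier W. len w \<le> L d}" for d
  have finite_B: "finite (B d)" for d
    using finite_carrier by (simp add: B_def)
  have "{w. proper_element W n s w} = {w \<in> carrier W. len (inv w) \<le> L (n - card (ascents (inv w)))}"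
    by (auto simp: proper_element_def left_descent_number_eq L_def)
  \<comment> \<open>Inversion permutes the group, preserves length and trades left descents for
    right ones.\<close>
  also have "\<dots> = (\<lambda>w. inv w) ` {w \<in> carrier W. len w \<le> L (n - card (ascents w))}"
    by (auto intro!: image_eqI[of _ "\<lambda>w. inv w" "inv _"]) 
  also have "card \<dots> = card {w \<in> carrier W. len w \<le> L (n - card (ascents w))}"
    by (intro card_image inj_onI) (metis (mono_tags, lifting) inv_inv mem_Collect_eq)
  \<comment> \<open>The length bound depends on the number of descents; on each slice it is constant
    and binomial inversion applies.\<close>
  also have "\<dots> = (\<Sum>d\<in>{0..n}. card {w \<in> {w \<in> carrier W. len w \<le> L (n - card (ascents w))}.
      n - card (ascents w) = d})"
    using finite_carrier by (simp only: card_eq_sum) (intro sum.group[symmetric]; auto)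
  also have "\<dots> = (\<Sum>d\<in>{0..n}. card {w \<in> B d. card (ascents w) = n - d})"
  proof (intro sum.cong HOL.refl arg_cong[of _ _ card] Collect_cong)
    fix d w assume d: "d \<in> {0..n}"
    have "card (ascents w) \<le> n" by (rule ascents_subset(3))
    with d have "n - card (ascents w) = d \<longleftrightarrow> card (ascents w) = n - d" by auto
    then show "(w \<in> {w \<in> carrier W. len w \<le> L (n - card (ascents w))} \<and> n - card (ascents w) = d) =
        (w \<in> B d \<and> card (ascents w) = n - d)"
      unfolding B_def by blast
  qed
  finally have "int (card {w. proper_element W n s w}) =
      (\<Sum>d\<in>{0..n}. int (card {w \<in> B d. card (ascents w) = n - d}))"
    by (simp only: of_nat_sum)
  also have "\<dots> = (\<Sum>d\<in>{0..n}. \<Sum>k\<in>{n - d..n}. (- 1) ^ (k - (n - d)) * binom k (n - d) *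
      (\<Sum>l\<le>L d. coeff (\<Sum>R\<in>subs S k. quotient_poly S R) l))"
  proof (rule sum.cong[OF HOL.refl])
    fix d
    have "int (card {w \<in> B d. card (ascents w) = n - d}) =
        (\<Sum>w\<in>B d. if card (ascents w) = n - d then 1 else 0)"
      using finite_B by (simp add: sum.If_cases Int_def)
    also have "\<dots> = (\<Sum>w\<in>B d. \<Sum>k\<in>{n - d..n}. (- 1) ^ (k - (n - d)) *
          int (k choose (n - d)) * int (card (ascents w) choose k))"
    proof (rule sum.cong[OF HOL.refl])
      fix w
      show "(if card (ascents w) = n - d then 1 else 0) = (\<Sum>k\<in>{n - d..n}. (- 1) ^ (k - (n - d)) *
          int (k choose (n - d)) * int (card (ascents w) choose k))"
        by (subst alternating_choose_sum) (auto simp: ascents_subset(3))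
    qed
    also have "\<dots> = (\<Sum>k\<in>{n - d..n}. \<Sum>w\<in>B d. (- 1) ^ (k - (n - d)) *
        int (k choose (n - d)) * int (card (ascents w) choose k))"
      by (rule sum.swap)
    finally show "int (card {w \<in> B d. card (ascents w) = n - d}) =
        (\<Sum>k\<in>{n - d..n}. (- 1) ^ (k - (n - d)) * binom k (n - d) *
          (\<Sum>l\<le>L d. coeff (\<Sum>R\<in>subs S k. quotient_poly S R) l))"
      unfolding sum_coeff_ascents binom_eq B_def by (simp only: sum_distrib_left)
  qed
  also have "\<dots> = (\<Sum>d\<in>{0..n}. \<Sum>k\<in>{n - d..n}. (- 1) ^ (k - (n - d)) * binom k (n - d) *
      sum_list (take (Suc (n + fst (nth_default (0, []) T d))) (snd (nth_default (0, []) T k))))"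
    by (intro sum.cong HOL.refl arg_cong2[of _ _ _ _ "(*)"])
      (simp add: T_max L_def maxw0_eq flip: T_poly sum_coeff_le del: coeff_Poly_eq)
  also have "\<dots> = proper_count n T"
    unfolding proper_count_def sum_list_distinct_conv_sum_set[OF distinct_upt] set_upt
    by (simp add: atLeastLessThanSuc_atLeastAtMost del: upt_Suc)
  finally show ?thesis .
qed

end

section \<open>The exceptional types\<close>

definition entry :: "'a list list \<Rightarrow> nat \<Rightarrow> nat \<Rightarrow> 'a" where
  "entry C i j = C ! (i - 1) ! (j - 1)"

definition realizes :: "nat \<Rightarrow> (nat \<Rightarrow> nat \<Rightarrow> nat) \<Rightarrow> (nat \<Rightarrow> nat \<Rightarrow> 'r::cone_ring) \<Rightarrow> bool" where
  "realizes n m c \<longleftrightarrow> (\<forall>i\<in>set [1..<Suc n]. \<forall>j\<in>set [1..<Suc n].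
     if i = j then c i i = 2 else bond (m i j) (c i j) (c j i))"

definition computed_count :: "nat \<Rightarrow> (nat \<Rightarrow> nat \<Rightarrow> 'r::cone_ring) \<Rightarrow> int" where
  "computed_count n c = proper_count n (quotient_table c [] [1..<Suc n] 0 (total_poly c [] [1..<Suc n]))"

lemma card_proper_elements_eq_computed_count:
  assumes "finite_coxeter_system W n s m" "realizes n m c"
  shows "int (card {w. proper_element W n s w}) = computed_count n c"
proof -
  have "set [1..<Suc n] = {1..n}" by auto
  then have "if i = j then c i i = 2 else bond (m i j) (c i j) (c j i)"
    if "i \<in> {1..n}" "j \<in> {1..n}" for i j
    using assms(2) that unfolding realizes_def by blast
  then have "geometric_coxeter_system W n s m c"
    using assms(1) unfolding geometric_coxeter_system_def geometric_coxeter_system_axioms_def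
    by metis
  from geometric_coxeter_system.card_proper_elements[OF this HOL.refl]
  show ?thesis by (simp add: computed_count_def)
qed

text \<open>The numbering nests the three types, so E6 and E7 use the leading blocks of the matrix
  of E8.\<close>

definition cartan_E :: "int list list" where
  "cartan_E =
    [[ 2,  0, -1,  0,  0,  0,  0,  0],
     [ 0,  2,  0, -1,  0,  0,  0,  0],
     [-1,  0,  2, -1,  0,  0,  0,  0],
     [ 0, -1, -1,  2, -1,  0,  0,  0],
     [ 0,  0,  0, -1,  2, -1,  0,  0],
     [ 0,  0,  0,  0, -1,  2, -1,  0],
     [ 0,  0,  0,  0,  0, -1,  2, -1],
     [ 0,  0,  0,  0,  0,  0, -1,  2]]"

text \<open>The asymmetric entries -2 and -1 replace the square root of 2, which keeps all
  coordinates integral.\<close>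

definition cartan_F :: "int list list" where
  "cartan_F =
    [[ 2, -1,  0,  0],
     [-1,  2, -2,  0],
     [ 0, -1,  2, -1],
     [ 0,  0, -1,  2]]"

text \<open>\<open>Golden 0 (-1)\<close> is \<open>- \<phi>\<close>, that is, minus twice the cosine
  of \<pi>/5; the leading block of size 3 belongs to H3.\<close>

definition cartan_H :: "golden list list" where
  "cartan_H =
    [[Golden 2 0, Golden 0 (-1), 0, 0],
     [Golden 0 (-1), Golden 2 0, Golden (-1) 0, 0],
     [0, Golden (-1) 0, Golden 2 0, Golden (-1) 0],
     [0, 0, Golden (-1) 0, Golden 2 0]]"

lemma realizes_E:
  "realizes 6 E6_matrix (entry cartan_E)"
  "realizes 7 E7_matrix (entry cartan_E)"
  "realizes 8 E8_matrix (entry cartan_E)"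
  by code_simp+

lemma realizes_F: "realizes 4 F4_matrix (entry cartan_F)"
  by code_simp

lemma realizes_H:
  "realizes 3 H3_matrix (entry cartan_H)"
  "realizes 4 H4_matrix (entry cartan_H)"
  by code_simp+

lemma count_F: "computed_count 4 (entry cartan_F) = 297"
  by code_simp

lemma count_H:
  "computed_count 3 (entry cartan_H) = 48"
  "computed_count 4 (entry cartan_H) = 594"
  by code_simp+

lemma count_E6: "computed_count 6 (entry cartan_E) = 10690"
  by code_simp


lemma count_E7: "computed_count 7 (entry cartan_E) = 159368"
  by code_simp

lemma count_E8: "computed_count 8 (entry cartan_E) = 4854344"
  by code_simp

theorem mainTheorem5:
  fixes W :: "('a, 'b) monoid_scheme" and s :: "nat \<Rightarrow> 'a"
  shows
    "(finite_coxeter_system W 6 s E6_matrix \<longrightarrow> card {w. proper_element W 6 s w} = 10690) \<and>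
     (finite_coxeter_system W 7 s E7_matrix \<longrightarrow> card {w. proper_element W 7 s w} = 159368) \<and>
     (finite_coxeter_system W 8 s E8_matrix \<longrightarrow> card {w. proper_element W 8 s w} = 4854344) \<and>
     (finite_coxeter_system W 4 s F4_matrix \<longrightarrow> card {w. proper_element W 4 s w} = 297) \<and>
     (finite_coxeter_system W 3 s H3_matrix \<longrightarrow> card {w. proper_element W 3 s w} = 48) \<and>
     (finite_coxeter_system W 4 s H4_matrix \<longrightarrow> card {w. proper_element W 4 s w} = 594)"
  using realizes_E realizes_F realizes_H count_E6 count_E7 count_E8 count_F count_H
  by (auto dest!: card_proper_elements_eq_computed_count)

end
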